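(* Let $N\ge1$, $1\le c_N\le 2e/5$, $\alpha>0$, and let $\mathbf{X}=(X_1,\dots,X_N)\sim\mathcal{N}_{\mathbb{C}^N}(0,B)$ and $\mathbf{Y}=(Y_1,\dots,Y_N)\in\mathbb{R}^N$ be two independent random vectors such that for every event $A\in\mathbf{Y}^{-1}(\mathcal{B}(\mathbb{R}^N))$ (of positive probability) there exists a random vector $\mathbf{Z}=(Z_1,\dots,Z_N)\sim\mathcal{N}_{\mathbb{C}^N}(0,B_A)$ on the same probability space satisfying: - for all $i\in\{1,\dots,N\}$, $\mathbb{E}(|Y_i|^2)\ge\alpha^2\,\mathbb{E}(|Z_i|^2)$ and $\mathbb{E}_A(|Y_i|^2)\le\mathbb{E}_A(|Z_i|^2)$; - for all $I\subsetneq\{1,\dots,N\}$, $\|C_I\|\,\|C_I^{-1}\|\le c_N$, where $C_I=\left(\frac{\mathrm{Cov}(Z_i,Z_j)}{\sqrt{V(Z_i)V(Z_j)}}\right)_{i,j\in I^c}$. Then, for all $x\in[0,+\infty)$, $$\mathbb{P}\left(\exists i\in\{1,\dots,N\}:\ |X_i|^2\ge x^2V(X_i)\ \text{and}\ |Y_i|^2\le e\,\frac{\mathbb{E}(|Y_i|^2)}{\alpha^2}\right)\ge1-5e\left(b\left(\mu(x)+(1-\mu(x))e^{-1/2}\right)\right)^N,$$ where $b=\|C\|\,\|C^{-1}\|$ with $C=\left(\frac{\mathrm{Cov}(X_i,X_j)}{\sqrt{V(X_i)V(X_j)}}\right)_{1\le i,j\le N}$ and $\mu(x)=1-e^{-x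^2/\|C\|}$.
   Context: For a positive definite Hermitian matrix $B$ of size $N$, $\mathcal{N}_{\mathbb{C}^N}(0,B)$ is the law on $\mathbb{C}^N$ with density $\frac{e^{-\langle z,B^{-1}z\rangle}}{\pi^N\det B}$ with respect to Lebesgue measure, $\langle,\rangle$ being the standard Hermitian product; then $\mathrm{Cov}(X_i,X_j)=\mathbb{E}(X_i\overline{X_j})=B_{ij}$ and $V(X_i)=\mathbb{E}(|X_i|^2)$. The matrices $B,B_A$ are positive definite Hermitian. $\|\cdot\|$ is the operator norm on Hermitian matrices for the standard Hermitian norm. $\mathbf{Y}^{-1}(\mathcal{B}(\mathbb{R}^N))$ is the $\sigma$-algebra generated by $\mathbf{Y}$. $\mathbb{E}_A(W)=\frac{1}{\mathbb{P}(A)}\int_AW\,d\mathbb{P}$ is the conditional expectation over $A$. $I^c=\{1,\dots,N\}\setminus I$. *)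

theory Defs
  imports "HOL-Probability.Probability"
begin

definition cinner_std :: "complex ^ 'n \<Rightarrow> complex ^ 'n \<Rightarrow> complex"
  where "cinner_std z w = (\<Sum>i\<in>UNIV. z $ i * cnj (w $ i))"

definition hermitian_matrix :: "complex ^ 'n ^ 'n \<Rightarrow> bool"
  where "hermitian_matrix B \<longleftrightarrow> (\<forall>i j. B $ i $ j = cnj (B $ j $ i))"

text \<open>For Hermitian \<open>B\<close> the quadratic form and the determinant are real, so taking real parts
  below loses nothing.\<close>

definition pos_def_hermitian :: "complex ^ 'n ^ 'n \<Rightarrow> bool"
  where "pos_def_hermitian B \<longleftrightarrow>
    hermitian_matrix B \<and> (\<forall>z. z \<noteq> 0 \<longrightarrow> 0 < Re (cinner_std z (B *v z)))"

definition complex_gaussian_density :: "complex ^ 'n ^ 'n \<Rightarrow> complex ^ 'n \<Rightarrow> real"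
  where "complex_gaussian_density B z =
    exp (- Re (cinner_std z (matrix_inv B *v z))) / (pi ^ CARD('n) * Re (det B))"

text \<open>\<open>lborel\<close> on \<open>complex ^ 'n\<close> is Lebesgue measure of real dimension \<open>2 * CARD('n)\<close>.\<close>

definition complex_gaussian :: "'a measure \<Rightarrow> ('a \<Rightarrow> complex ^ 'n) \<Rightarrow> complex ^ 'n ^ 'n \<Rightarrow> bool"
  where "complex_gaussian M X B \<longleftrightarrow>
    pos_def_hermitian B \<and> distributed M lborel X (\<lambda>z. ennreal (complex_gaussian_density B z))"

definition ccov :: "'a measure \<Rightarrow> ('a \<Rightarrow> complex) \<Rightarrow> ('a \<Rightarrow> complex) \<Rightarrow> complex"
  where "ccov M U V =
    (\<integral>\<omega>. (U \<omega> - integral\<^sup>L M U) * cnj (V \<omega> - integral\<^sup>L M V) \<partial>M)"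

definition cvar :: "'a measure \<Rightarrow> ('a \<Rightarrow> complex) \<Rightarrow> real"
  where "cvar M U = (\<integral>\<omega>. (cmod (U \<omega> - integral\<^sup>L M U))\<^sup>2 \<partial>M)"

definition corr_matrix :: "'a measure \<Rightarrow> ('a \<Rightarrow> complex ^ 'n) \<Rightarrow> complex ^ 'n ^ 'n"
  where "corr_matrix M X = (\<chi> i j. ccov M (\<lambda>\<omega>. X \<omega> $ i) (\<lambda>\<omega>. X \<omega> $ j) /
    complex_of_real (sqrt (cvar M (\<lambda>\<omega>. X \<omega> $ i) * cvar M (\<lambda>\<omega>. X \<omega> $ j))))"

definition op_norm :: "complex ^ 'n ^ 'n \<Rightarrow> real"
  where "op_norm A = onorm (\<lambda>v. A *v v)"

text \<open>A matrix with rows and columns indexed by a subset \<open>J\<close> of the index type is represented by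
  its extension by zero outside \<open>J \<times> J\<close>. As an operator this is the original matrix on
  the vectors supported on \<open>J\<close> and zero on their orthogonal complement, so \<open>op_norm\<close> of it is
  the operator norm of the original matrix. Its inverse as a \<open>J \<times> J\<close> matrix is not
  \<open>matrix_inv\<close>, but the matrix that is again supported on \<open>J \<times> J\<close> and inverts it with
  respect to the identity matrix of \<open>J\<close>.\<close>

definition submatrix_on :: "'n set \<Rightarrow> complex ^ 'n ^ 'n \<Rightarrow> complex ^ 'n ^ 'n"
  where "submatrix_on J A = (\<chi> i j. if i \<in> J \<and> j \<in> J then A $ i $ j else 0)"

definition submatrix_inv :: "'n set \<Rightarrow> complex ^ 'n ^ 'n \<Rightarrow> complex ^ 'n ^ 'n"
  where "submatrix_inv J A = (SOME A'. submatrix_on J A' = A' \<and>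
    submatrix_on J A ** A' = submatrix_on J (mat 1) \<and>
    A' ** submatrix_on J A = submatrix_on J (mat 1))"

definition expectation_over :: "'a measure \<Rightarrow> 'a set \<Rightarrow> ('a \<Rightarrow> real) \<Rightarrow> real"
  where "expectation_over M A W = (LINT \<omega>:A|M. W \<omega>) / measure M A"

text \<open>The library's \<open>indep_var\<close> requires both variables to have the same value type.\<close>

definition indep_vectors ::
  "'a measure \<Rightarrow> ('a \<Rightarrow> 'b::topological_space) \<Rightarrow> ('a \<Rightarrow> 'c::topological_space) \<Rightarrow> bool"
  where "indep_vectors M X Y \<longleftrightarrow> X \<in> borel_measurable M \<and> Y \<in> borel_measurable M \<and>
    prob_space.indep_set M
      (sets (vimage_algebra (space M) X borel)) (sets (vimage_algebra (space M) Y borel))"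

end

theory Submission
  imports Defs "HOL-Real_Asymp.Real_Asymp"
begin

text \<open>
  Let \<open>S\<close> be the random set of indices where \<open>Y\<close> exceeds its threshold. The bad event
  says that the normalised \<open>X\<close> lies in a polydisc in the coordinates outside \<open>S\<close>, so by
  independence it suffices to bound the polydisc probabilities and to average over \<open>S\<close>.

  Between \<open>exp (- norm (inv C) |z|\<^sup>2)\<close> and \<open>exp (- |z|\<^sup>2 / norm C)\<close> the Gaussian density is squeezed
  by products of functions of one complex variable, which gives
  \<open>b\<^sup>N \<mu>\<^bsup>card (- S)\<^esup>\<close> for the polydisc. Expanding \<open>\<mu>\<^bsup>card (- S)\<^esup>\<close> over the subsets of \<open>S\<close> leaves
  the probabilities of \<open>J \<subseteq> S\<close>. On this event the coordinates \<open>Z\<^sub>i\<close> with \<open>i \<in> J\<close> have conditional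
  second moment at least \<open>e\<close> times their variance, while the eigenvalues of the correlation
  matrix of \<open>Z\<close> on \<open>J\<close> are at most \<open>2e/5\<close>; an exponential moment bound gives the decay
  \<open>exp (- card J / 2)\<close>.\<close>

section \<open>Radial integrals on complex coordinate space\<close>

lemma box_vec_eq: "box l (u :: 'a::euclidean_space ^ 'n) = {z. \<forall>i. z $ i \<in> box (l $ i) (u $ i)}"
  by (auto simp: box_def Basis_vec_def inner_axis)

lemma prod_Basis_vec:
  "(\<Prod>b\<in>Basis. f b) = (\<Prod>i\<in>UNIV. \<Prod>b\<in>Basis. f (axis i b :: 'a::euclidean_space ^ 'n))"
proof -
  have eq: "(Basis :: ('a ^ 'n) set) = (\<lambda>(i, b). axis i b) ` (UNIV \<times> Basis)"
    by (auto simp: Basis_vec_def)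
  have inj: "inj_on (\<lambda>(i, b). axis i b :: 'a ^ 'n) (UNIV \<times> Basis)"
    by (auto simp: inj_on_def axis_eq_axis)
  show ?thesis
    unfolding eq prod.reindex[OF inj] by (simp add: prod.cartesian_product split_def)
qed

lemma measurable_vec_lambda [measurable]:
  "vec_lambda \<in> (\<Pi>\<^sub>M i\<in>(UNIV :: 'n::finite set). (borel :: 'a::euclidean_space measure)) \<rightarrow>\<^sub>M borel"
proof (rule borel_measurable_euclidean_space[THEN iffD2], rule ballI)
  fix b :: "'a ^ 'n" assume "b \<in> Basis"
  then obtain i u where b: "b = axis i u"
    by (auto simp: Basis_vec_def)
  show "(\<lambda>x. vec_lambda x \<bullet> b) \<in> borel_measurable (\<Pi>\<^sub>M i\<in>(UNIV :: 'n set). (borel :: 'a measure))"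
    unfolding b inner_axis by simp
qed

text \<open>Both measures give a box the product of its side lengths, and the values on boxes
  determine Lebesgue measure. All coordinatewise integration below rests on this.\<close>

lemma lborel_vec:
  "(lborel :: ('a::euclidean_space ^ 'n) measure) = distr (\<Pi>\<^sub>M i\<in>UNIV. lborel) borel vec_lambda"
proof (rule lborel_eqI)
  interpret product_sigma_finite "\<lambda>_::'n. lborel :: 'a measure" by standard
  have m [measurable]: "vec_lambda \<in> (\<Pi>\<^sub>M i\<in>(UNIV :: 'n set). (lborel :: 'a measure)) \<rightarrow>\<^sub>M borel"
    using measurable_vec_lambda by (simp cong: measurable_cong_sets sets_PiM_cong)
  fix l u :: "'a ^ 'n" assume le: "\<And>b. b \<in> Basis \<Longrightarrow> l \<bullet> b \<le> u \<bullet> b"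
  have le': "l $ i \<bullet> b \<le> u $ i \<bullet> b" if "b \<in> Basis" for i b
    using le[of "axis i b"] that by (auto simp: Basis_vec_def inner_axis)
  have vimage: "vec_lambda -` box l u \<inter> space (\<Pi>\<^sub>M i\<in>(UNIV :: 'n set). (lborel :: 'a measure))
      = (\<Pi>\<^sub>E i\<in>UNIV. box (l $ i) (u $ i))"
    by (auto simp: box_vec_eq space_PiM)
  have "emeasure (distr (\<Pi>\<^sub>M i\<in>UNIV. lborel) borel vec_lambda) (box l u)
      = (\<Prod>i\<in>UNIV. emeasure lborel (box (l $ i) (u $ i)))"
    by (simp add: emeasure_distr vimage emeasure_PiM)
  also have "\<dots> = (\<Prod>i\<in>UNIV. ennreal (\<Prod>b\<in>Basis. (u - l) \<bullet> (axis i b)))"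
    using le' by (intro prod.cong refl) (simp add: emeasure_lborel_box inner_axis)
  also have "\<dots> = ennreal (\<Prod>b\<in>Basis. (u - l) \<bullet> b)"
    unfolding prod_Basis_vec using le'
    by (intro prod_ennreal prod_nonneg) (simp add: inner_axis inner_diff_left)
  finally show "emeasure (distr (\<Pi>\<^sub>M i\<in>UNIV. lborel) borel vec_lambda) (box l u) =
    ennreal (\<Prod>b\<in>Basis. (u - l) \<bullet> b)" .
qed simp

lemma borel_measurable_vec_nth [measurable]:
  "(\<lambda>z :: 'a::euclidean_space ^ 'n. z $ i) \<in> borel_measurable borel"
  by (intro borel_measurable_continuous_onI continuous_intros)

lemma nn_integral_lborel_vec_prod:
  fixes f :: "'n::finite \<Rightarrow> 'a::euclidean_space \<Rightarrow> ennreal"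
  assumes [measurable]: "\<And>i. f i \<in> borel_measurable borel"
  shows "(\<integral>\<^sup>+z. (\<Prod>i\<in>UNIV. f i (z $ i)) \<partial>(lborel :: ('a ^ 'n) measure))
    = (\<Prod>i\<in>UNIV. \<integral>\<^sup>+z. f i z \<partial>lborel)"
proof -
  interpret product_sigma_finite "\<lambda>_::'n. lborel :: 'a measure" by standard
  have m [measurable]: "vec_lambda \<in> (\<Pi>\<^sub>M i\<in>(UNIV :: 'n set). (lborel :: 'a measure)) \<rightarrow>\<^sub>M borel"
    using measurable_vec_lambda by (simp cong: measurable_cong_sets sets_PiM_cong)
  show ?thesis
    by (subst lborel_vec, subst nn_integral_distr) (auto intro!: product_nn_integral_prod)
qed

text \<open>A disc of squared radius \<open>s\<close> has area \<open>pi * s\<close>, so the squared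
  modulus has constant density \<open>pi\<close> on a half-line. The sign is there because measures
  are compared on rays \<open>{x<..}\<close>, which must have finite measure; negation turns their
  preimages into bounded discs.\<close>

lemma distr_neg_cmod_square:
  "distr lborel borel (\<lambda>z. - (cmod z)\<^sup>2) = density lborel (\<lambda>u. ennreal pi * indicator {..0} u)"
proof (rule measure_eqI_lessThan)
  fix x :: real
  have l: "emeasure (distr lborel borel (\<lambda>z. - (cmod z)\<^sup>2)) {x<..} = ennreal (pi * max 0 (- x))"
  proof -
    have "emeasure (distr lborel borel (\<lambda>z. - (cmod z)\<^sup>2)) {x<..}
        = emeasure lborel {z :: complex. (cmod z)\<^sup>2 < - x}"
      by (subst emeasure_distr) (auto simp: vimage_def intro!: arg_cong[where f = "emeasure lborel"])
    also have "{z :: complex. (cmod z)\<^sup>2 < - x} = ball 0 (sqrt (max 0 (- x)))"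
    proof (cases "x < 0")
      case True
      have "(cmod z)\<^sup>2 < - x \<longleftrightarrow> cmod z < sqrt (- x)" for z
        using real_sqrt_less_iff[of "(cmod z)\<^sup>2" "- x"] by (simp del: real_sqrt_less_iff)
      with True show ?thesis by (simp add: set_eq_iff)
    next
      case False
      then have "\<not> (cmod z)\<^sup>2 < - x" for z
        by (meson le_less_trans neg_0_less_iff_less not_less zero_le_power2)
      with False show ?thesis by auto
    qed
    also have "emeasure lborel \<dots> = ennreal (pi * max 0 (- x))"
      by (subst emeasure_ball) (auto simp: unit_ball_vol_2 eval_unit_ball_vol)
    finally show ?thesis .
  qed
  then show "emeasure (distr lborel borel (\<lambda>z. - (cmod z)\<^sup>2)) {x<..} < \<infinity>" by simp
  have "emeasure (density lborel (\<lambda>u. ennreal pi * indicator {..0} u)) {x<..}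
      = (\<integral>\<^sup>+u. ennreal pi * indicator {x<..0} u \<partial>lborel)"
    by (subst emeasure_density) (auto intro!: nn_integral_cong split: split_indicator)
  also have "\<dots> = ennreal pi * emeasure lborel {x<..0}"
    by (subst nn_integral_cmult_indicator) auto
  also have "\<dots> = ennreal (pi * max 0 (- x))"
    by (cases "x \<le> 0") (auto simp: ennreal_mult'[symmetric])
  finally show "emeasure (distr lborel borel (\<lambda>z. - (cmod z)\<^sup>2)) {x<..} =
      emeasure (density lborel (\<lambda>u. ennreal pi * indicator {..0} u)) {x<..}"
    using l by simp
qed auto

lemma nn_integral_cmod_square:
  assumes [measurable]: "f \<in> borel_measurable borel"
  shows "(\<integral>\<^sup>+z. f ((cmod z)\<^sup>2) \<partial>lborel) = ennreal pi * (\<integral>\<^sup>+u. f u * indicator {0..} u \<partial>lborel)"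
proof -
  have "(\<integral>\<^sup>+z. f ((cmod z)\<^sup>2) \<partial>lborel) = (\<integral>\<^sup>+u. f (- u) \<partial>distr lborel borel (\<lambda>z. - (cmod z)\<^sup>2))"
    by (subst nn_integral_distr) auto
  also have "\<dots> = (\<integral>\<^sup>+u. ennreal pi * indicator {..0} u * f (- u) \<partial>lborel)"
    unfolding distr_neg_cmod_square by (subst nn_integral_density) auto
  \<comment> \<open>The reflection of \<open>u\<close> undoes the sign.\<close>
  also have "\<dots> = (\<integral>\<^sup>+u. ennreal pi * (f u * indicator {0..} u) \<partial>lborel)"
    by (subst nn_integral_real_affine[where c = "-1" and t = 0])
       (auto intro!: nn_integral_cong split: split_indicator)
  also have "\<dots> = ennreal pi * (\<integral>\<^sup>+u. f u * indicator {0..} u \<partial>lborel)"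
    by (rule nn_integral_cmult) auto
  finally show ?thesis .
qed

lemma nn_integral_exp_cmod_square:
  assumes "0 < a"
  shows "(\<integral>\<^sup>+z. ennreal (exp (- (a * (cmod z)\<^sup>2))) \<partial>lborel) = ennreal (pi / a)"
proof -
  have lim: "((\<lambda>u. - exp (- (a * u)) / a) \<longlongrightarrow> 0) at_top"
  proof -
    have "filterlim (\<lambda>u. a * u) at_top at_top"
      using assms by (simp add: filterlim_tendsto_pos_mult_at_top[OF tendsto_const _ filterlim_ident])
    then have "((\<lambda>u. exp (- (a * u))) \<longlongrightarrow> 0) at_top"
      by (intro filterlim_compose[OF exp_at_bot] filterlim_compose[OF filterlim_uminus_at_bot_at_top])
    from tendsto_divide[OF tendsto_minus[OF this] tendsto_const[of a]] assms show ?thesis by simp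
  qed
  have "(\<integral>\<^sup>+u. ennreal (exp (- (a * u))) * indicator {0..} u \<partial>lborel)
      = ennreal (0 - (- exp (- (a * 0)) / a))"
    by (rule nn_integral_FTC_atLeast[OF _ _ _ lim])
       (use assms in \<open>auto intro!: derivative_eq_intros\<close>)
  then show ?thesis
    using nn_integral_cmod_square[of "\<lambda>u. ennreal (exp (- (a * u)))"] assms
    by (simp add: ennreal_mult'[symmetric])
qed

lemma nn_integral_exp_cmod_square_disc:
  assumes "0 < a" "0 \<le> r"
  shows "(\<integral>\<^sup>+z. ennreal (exp (- (a * (cmod z)\<^sup>2))) * indicator {z. (cmod z)\<^sup>2 \<le> r} z \<partial>lborel)
    = ennreal (pi / a * (1 - exp (- (a * r))))"
proof -
  have "(\<integral>\<^sup>+u. ennreal (exp (- (a * u))) * indicator {0..r} u \<partial>lborel)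
      = ennreal (- exp (- (a * r)) / a - (- exp (- (a * 0)) / a))"
  proof (rule nn_integral_FTC_Icc)
    fix u :: real
    show "((\<lambda>u. - exp (- (a * u)) / a) has_real_derivative exp (- (a * u))) (at u)"
      using assms by (auto intro!: derivative_eq_intros)
  qed (use assms in auto)
  moreover have "(\<integral>\<^sup>+u. ennreal (exp (- (a * u))) * indicator {..r} u * indicator {0..} u \<partial>lborel)
      = (\<integral>\<^sup>+u. ennreal (exp (- (a * u))) * indicator {0..r} u \<partial>lborel)"
    by (intro nn_integral_cong) (auto split: split_indicator)
  moreover have "(\<integral>\<^sup>+z. ennreal (exp (- (a * (cmod z)\<^sup>2))) * indicator {z. (cmod z)\<^sup>2 \<le> r} z \<partial>lborel)
      = (\<integral>\<^sup>+z. ennreal (exp (- (a * (cmod z)\<^sup>2))) * indicator {..r} ((cmod z)\<^sup>2) \<partial>lborel)"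
    by (intro nn_integral_cong) (auto split: split_indicator)
  ultimately show ?thesis
    using nn_integral_cmod_square[of "\<lambda>u. ennreal (exp (- (a * u))) * indicator {..r} u"] assms
    by (simp add: ennreal_mult'[symmetric] field_simps)
qed

section \<open>Moments of complex Gaussian vectors\<close>

text \<open>From here on quadratic forms are written with the real inner product, for which a
  Hermitian matrix is again self-adjoint.\<close>

lemma Re_cinner_std: "Re (cinner_std z w) = z \<bullet> w"
  by (simp add: cinner_std_def inner_vec_def inner_complex_def)

lemma hermitian_matrix_inner:
  assumes "hermitian_matrix A"
  shows "(A *v z) \<bullet> w = z \<bullet> (A *v w)"
proof -
  have "cinner_std (A *v z) w = (\<Sum>i\<in>UNIV. \<Sum>j\<in>UNIV. A $ i $ j * z $ j * cnj (w $ i))"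
    by (simp add: cinner_std_def matrix_vector_mult_def sum_distrib_right)
  also have "\<dots> = (\<Sum>j\<in>UNIV. \<Sum>i\<in>UNIV. A $ i $ j * z $ j * cnj (w $ i))"
    by (rule sum.swap)
  also have "\<dots> = (\<Sum>j\<in>UNIV. \<Sum>i\<in>UNIV. z $ j * cnj (A $ j $ i * w $ i))"
  proof (intro sum.cong refl)
    fix i j
    have "A $ i $ j = cnj (A $ j $ i)"
      using assms unfolding hermitian_matrix_def by blast
    then show "A $ i $ j * z $ j * cnj (w $ i) = z $ j * cnj (A $ j $ i * w $ i)"
      by simp
  qed
  also have "\<dots> = cinner_std z (A *v w)"
    by (simp add: cinner_std_def matrix_vector_mult_def sum_distrib_left)
  finally show ?thesis by (metis Re_cinner_std)
qed

lemma pos_def_hermitian_iff: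
  "pos_def_hermitian A \<longleftrightarrow> hermitian_matrix A \<and> (\<forall>z. z \<noteq> 0 \<longrightarrow> 0 < z \<bullet> (A *v z))"
  by (simp add: pos_def_hermitian_def Re_cinner_std)

text \<open>Definiteness leaves only 0 in the kernel, so the square matrix is invertible.\<close>

lemma pos_def_hermitian_matrix_inv:
  assumes "pos_def_hermitian A"
  shows "A ** matrix_inv A = mat 1" and "matrix_inv A ** A = mat 1"
proof -
  have "invertible A"
    unfolding invertible_left_inverse matrix_left_invertible_injective
  proof (rule injI)
    fix z w assume "A *v z = A *v w"
    then have "(z - w) \<bullet> (A *v (z - w)) = 0"
      by (simp add: matrix_vector_mult_diff_distrib)
    with assms show "z = w"
      by (metis less_irrefl pos_def_hermitian_iff right_minus_eq)
  qed
  then have "A ** matrix_inv A = mat 1 \<and> matrix_inv A ** A = mat 1"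
    unfolding invertible_def matrix_inv_def by (rule someI_ex)
  then show "A ** matrix_inv A = mat 1" "matrix_inv A ** A = mat 1"
    by simp_all
qed

text \<open>Self-adjointness of \<open>A\<close>, applied to the preimages of \<open>z\<close> and
  \<open>w\<close>.\<close>

lemma pos_def_hermitian_matrix_inv_inner:
  assumes "pos_def_hermitian A"
  shows "(matrix_inv A *v z) \<bullet> w = z \<bullet> (matrix_inv A *v w)"
proof -
  have inv: "A *v (matrix_inv A *v u) = u" for u
    by (simp add: matrix_vector_mul_assoc pos_def_hermitian_matrix_inv[OF assms])
  have "hermitian_matrix A"
    using assms by (simp add: pos_def_hermitian_def)
  from hermitian_matrix_inner[OF this, of "matrix_inv A *v z" "matrix_inv A *v w"]
  show ?thesis by (simp add: inv)
qed

lemma borel_measurable_matrix_vector_mult [measurable]: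
  "(*v) (A :: complex ^ 'n ^ 'm) \<in> borel_measurable borel"
  by (intro borel_measurable_continuous_onI linear_continuous_on matrix_vector_mul_bounded_linear)

text \<open>Completing the square and translating.\<close>

lemma nn_integral_exp_quadratic_shift:
  fixes Q :: "complex ^ 'n ^ 'n"
  assumes sym: "\<And>z w. (Q *v z) \<bullet> w = z \<bullet> (Q *v w)"
  shows "(\<integral>\<^sup>+z. ennreal (exp (2 * (z \<bullet> (Q *v h)) - z \<bullet> (Q *v z))) \<partial>lborel)
    = ennreal (exp (h \<bullet> (Q *v h))) * (\<integral>\<^sup>+z. ennreal (exp (- (z \<bullet> (Q *v z)))) \<partial>lborel)"
proof -
  have "(\<integral>\<^sup>+z. ennreal (exp (2 * (z \<bullet> (Q *v h)) - z \<bullet> (Q *v z))) \<partial>lborel)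
      = (\<integral>\<^sup>+z. ennreal (exp (2 * (z \<bullet> (Q *v h)) - z \<bullet> (Q *v z))) \<partial>distr lborel borel ((+) h))"
    by (simp add: lborel_distr_plus)
  also have "\<dots> = (\<integral>\<^sup>+z. ennreal (exp (2 * ((h + z) \<bullet> (Q *v h)) - (h + z) \<bullet> (Q *v (h + z)))) \<partial>lborel)"
    by (subst nn_integral_distr) auto
  also have "\<dots> = (\<integral>\<^sup>+z. ennreal (exp (h \<bullet> (Q *v h))) * ennreal (exp (- (z \<bullet> (Q *v z)))) \<partial>lborel)"
  proof (intro nn_integral_cong)
    fix z
    \<comment> \<open>By symmetry the two cross terms of the shifted quadratic form coincide and
      cancel against the linear term in \<open>z\<close>.\<close>
    have "h \<bullet> (Q *v z) = z \<bullet> (Q *v h)"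
      by (metis inner_commute sym)
    then have "2 * ((h + z) \<bullet> (Q *v h)) - (h + z) \<bullet> (Q *v (h + z)) = h \<bullet> (Q *v h) + - (z \<bullet> (Q *v z))"
      by (simp add: matrix_vector_right_distrib inner_add_left inner_add_right)
    then show "ennreal (exp (2 * ((h + z) \<bullet> (Q *v h)) - (h + z) \<bullet> (Q *v (h + z))))
        = ennreal (exp (h \<bullet> (Q *v h))) * ennreal (exp (- (z \<bullet> (Q *v z))))"
      by (simp only: exp_add ennreal_mult' exp_ge_zero)
  qed
  finally show ?thesis
    by (simp add: nn_integral_cmult)
qed

text \<open>The normalising constant is determined by the total mass, so the determinant in the
  density never has to be computed.\<close>

lemma complex_gaussian_nn_integral:
  fixes B :: "complex ^ 'n ^ 'n"
  assumes "prob_space M" "complex_gaussian M X B"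
  shows "\<exists>\<kappa>>0. ennreal \<kappa> * (\<integral>\<^sup>+z. ennreal (exp (- (z \<bullet> (matrix_inv B *v z)))) \<partial>lborel) = 1 \<and>
    (\<forall>f\<in>borel_measurable borel. (\<integral>\<^sup>+\<omega>. f (X \<omega>) \<partial>M)
      = ennreal \<kappa> * (\<integral>\<^sup>+z. ennreal (exp (- (z \<bullet> (matrix_inv B *v z)))) * f z \<partial>lborel))"
proof -
  interpret prob_space M by fact
  have d: "distributed M lborel X (\<lambda>z. ennreal (complex_gaussian_density B z))"
    using assms(2) by (simp add: complex_gaussian_def)
  define \<kappa> where "\<kappa> = 1 / (pi ^ CARD('n) * Re (det B))"
  have dens: "complex_gaussian_density B z = \<kappa> * exp (- (z \<bullet> (matrix_inv B *v z)))" for z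
    by (simp add: complex_gaussian_density_def Re_cinner_std \<kappa>_def)
  have total: "(\<integral>\<^sup>+z. ennreal (complex_gaussian_density B z) \<partial>lborel) = 1"
    using distributed_nn_integral[OF d, of "\<lambda>_. 1"] by (simp add: emeasure_space_1)
  \<comment> \<open>\<open>ennreal\<close> sends nonpositive reals to 0, so otherwise the density
    would vanish everywhere, against total mass 1.\<close>
  have "0 < \<kappa>"
  proof (rule ccontr)
    assume "\<not> 0 < \<kappa>"
    then have "ennreal (complex_gaussian_density B z) = 0" for z
      unfolding dens by (intro ennreal_neg) (simp add: mult_nonpos_nonneg)
    with total show False by simp
  qed
  have *: "(\<integral>\<^sup>+\<omega>. f (X \<omega>) \<partial>M)
      = ennreal \<kappa> * (\<integral>\<^sup>+z. ennreal (exp (- (z \<bullet> (matrix_inv B *v z)))) * f z \<partial>lborel)"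
    if [measurable]: "f \<in> borel_measurable borel" for f
  proof -
    have "(\<integral>\<^sup>+\<omega>. f (X \<omega>) \<partial>M) = (\<integral>\<^sup>+z. ennreal (complex_gaussian_density B z) * f z \<partial>lborel)"
      by (rule distributed_nn_integral[OF d, symmetric]) simp
    also have "\<dots> = (\<integral>\<^sup>+z. ennreal \<kappa> * (ennreal (exp (- (z \<bullet> (matrix_inv B *v z)))) * f z) \<partial>lborel)"
      using \<open>0 < \<kappa>\<close> by (simp add: dens ennreal_mult' mult.assoc)
    also have "\<dots> = ennreal \<kappa> * (\<integral>\<^sup>+z. ennreal (exp (- (z \<bullet> (matrix_inv B *v z)))) * f z \<partial>lborel)"
      by (rule nn_integral_cmult) simp
    finally show ?thesis .
  qed
  from *[of "\<lambda>_. 1"] have "ennreal \<kappa> * (\<integral>\<^sup>+z. ennreal (exp (- (z \<bullet> (matrix_inv B *v z)))) \<partial>lborel) = 1"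
    by (simp add: emeasure_space_1)
  with \<open>0 < \<kappa>\<close> show ?thesis
    using * by blast
qed

lemma complex_gaussian_measurable:
  assumes "complex_gaussian M X B"
  shows "X \<in> borel_measurable M"
  using assms distributed_measurable by (force simp: complex_gaussian_def)

text \<open>Since \<open>Q *v (B *v w) = w\<close>, the linear term
  \<open>2 * (z \<bullet> w)\<close> is the one that the shift \<open>h = B *v w\<close> absorbs.
  The shift leaves the factor \<open>exp (h \<bullet> (Q *v h))\<close> times a total mass of
  1.\<close>

lemma complex_gaussian_mgf:
  assumes "prob_space M" "complex_gaussian M X B"
  shows "(\<integral>\<^sup>+\<omega>. ennreal (exp (2 * (X \<omega> \<bullet> w))) \<partial>M) = ennreal (exp (w \<bullet> (B *v w)))"
proof -
  have pd: "pos_def_hermitian B"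
    using assms(2) by (simp add: complex_gaussian_def)
  define Q where "Q = matrix_inv B"
  have sym: "(Q *v z) \<bullet> u = z \<bullet> (Q *v u)" for z u
    unfolding Q_def by (rule pos_def_hermitian_matrix_inv_inner[OF pd])
  have inv: "Q *v (B *v w) = w"
    by (simp add: Q_def matrix_vector_mul_assoc pos_def_hermitian_matrix_inv[OF pd])
  obtain \<kappa> where \<kappa>: "0 < \<kappa>"
    and total: "ennreal \<kappa> * (\<integral>\<^sup>+z. ennreal (exp (- (z \<bullet> (Q *v z)))) \<partial>lborel) = 1"
    and nn: "\<forall>f\<in>borel_measurable borel. (\<integral>\<^sup>+\<omega>. f (X \<omega>) \<partial>M)
      = ennreal \<kappa> * (\<integral>\<^sup>+z. ennreal (exp (- (z \<bullet> (Q *v z)))) * f z \<partial>lborel)"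
    unfolding Q_def using complex_gaussian_nn_integral[OF assms] by blast
  have "(\<integral>\<^sup>+\<omega>. ennreal (exp (2 * (X \<omega> \<bullet> w))) \<partial>M)
      = ennreal \<kappa> * (\<integral>\<^sup>+z. ennreal (exp (- (z \<bullet> (Q *v z)))) * ennreal (exp (2 * (z \<bullet> w))) \<partial>lborel)"
    using nn by (rule bspec) simp
  also have "(\<lambda>z. ennreal (exp (- (z \<bullet> (Q *v z)))) * ennreal (exp (2 * (z \<bullet> w))))
      = (\<lambda>z. ennreal (exp (2 * (z \<bullet> (Q *v (B *v w))) - z \<bullet> (Q *v z))))"
    by (simp add: inv ennreal_mult'[symmetric] exp_add[symmetric])
  also have "(\<integral>\<^sup>+z. \<dots> z \<partial>lborel) = ennreal (exp ((B *v w) \<bullet> (Q *v (B *v w)))) *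
      (\<integral>\<^sup>+z. ennreal (exp (- (z \<bullet> (Q *v z)))) \<partial>lborel)"
    by (rule nn_integral_exp_quadratic_shift[OF sym])
  finally show ?thesis
    unfolding inv mult.left_commute[of "ennreal \<kappa>"] total by (simp add: inner_commute)
qed

section \<open>Second moments from the moment generating function\<close>

lemma exp_add_exp_minus_le:
  fixes y :: real
  shows "0 \<le> exp y + exp (- y) - 2" and "exp y + exp (- y) - 2 \<le> y\<^sup>2 * exp \<bar>y\<bar>"
proof -
  \<comment> \<open>The quantity is the square of \<open>2 * sinh (y / 2)\<close>, whence
    nonnegativity; the upper bound then comes from \<open>1 - exp (- t) \<le> t\<close> at
    \<open>t = \<bar>y\<bar>\<close>.\<close>
  have eq: "exp y + exp (- y) - 2 = (exp (\<bar>y\<bar> / 2) - exp (- (\<bar>y\<bar> / 2)))\<^sup>2" for y :: real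
    by (cases "0 \<le> y")
       (simp_all add: power2_diff flip: exp_double exp_add)
  show "0 \<le> exp y + exp (- y) - 2"
    unfolding eq by simp
  have "exp (\<bar>y\<bar> / 2) - exp (- (\<bar>y\<bar> / 2)) = exp (\<bar>y\<bar> / 2) * (1 - exp (- \<bar>y\<bar>))"
    by (simp add: right_diff_distrib flip: exp_add)
  also have "\<dots> \<le> exp (\<bar>y\<bar> / 2) * \<bar>y\<bar>"
    using exp_ge_add_one_self[of "- \<bar>y\<bar>"] by (intro mult_left_mono) auto
  finally have "(exp (\<bar>y\<bar> / 2) - exp (- (\<bar>y\<bar> / 2)))\<^sup>2 \<le> (exp (\<bar>y\<bar> / 2) * \<bar>y\<bar>)\<^sup>2"
    by (intro power_mono) auto
  then show "exp y + exp (- y) - 2 \<le> y\<^sup>2 * exp \<bar>y\<bar>"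
    unfolding eq by (simp add: power_mult_distrib mult.commute flip: exp_double)
qed

lemma square_le_exp_abs: "y\<^sup>2 \<le> 2 * exp \<bar>y :: real\<bar>"
  using exp_lower_Taylor_quadratic[of "\<bar>y\<bar>"] by simp

text \<open>The correlation matrix expressed through the entries of the covariance matrix, so that
  norm estimates involve no integrals; \<open>complex_gaussian_corr_matrix\<close> makes the link to
  \<open>corr_matrix\<close>.\<close>

definition normalized_matrix :: "complex ^ 'n ^ 'n \<Rightarrow> complex ^ 'n ^ 'n"
  where "normalized_matrix B =
    (\<chi> i j. B $ i $ j / complex_of_real (sqrt (Re (B $ i $ i) * Re (B $ j $ j))))"

context prob_space begin

text \<open>The second moment is the limit of the second difference quotients of the moment
  generating function at zero.\<close>

lemma moments_of_mgf:
  fixes R :: "'a \<Rightarrow> real"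
  assumes [measurable]: "R \<in> borel_measurable M"
    and int: "\<And>s. integrable M (\<lambda>\<omega>. exp (s * R \<omega>))"
    and mgf: "\<And>s. expectation (\<lambda>\<omega>. exp (s * R \<omega>)) = exp (s\<^sup>2 * v)"
  shows "integrable M R" and "expectation R = 0"
    and "integrable M (\<lambda>\<omega>. (R \<omega>)\<^sup>2)" and "expectation (\<lambda>\<omega>. (R \<omega>)\<^sup>2) = 2 * v"
proof -
  have int2: "integrable M (\<lambda>\<omega>. exp (s * R \<omega>) + exp (- (s * R \<omega>)))" for s
    using int[of s] int[of "- s"] by simp
  have exp_abs: "exp \<bar>y\<bar> \<le> exp y + exp (- y)" for y :: real
    by (cases "0 \<le> y") auto
  have sq: "y\<^sup>2 \<le> 2 * (exp y + exp (- y))" for y :: real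
    by (rule order_trans[OF square_le_exp_abs]) (use exp_abs[of y] in simp)
  show int_sq: "integrable M (\<lambda>\<omega>. (R \<omega>)\<^sup>2)"
    by (rule Bochner_Integration.integrable_bound[OF integrable_mult_right[OF int2[of 1], of 2]])
       (use sq in \<open>auto simp: abs_of_nonneg add_nonneg_nonneg\<close>)
  show int_R: "integrable M R"
    using square_integrable_imp_integrable[OF assms(1) int_sq] .
  \<comment> \<open>This is \<open>1 + y \<le> exp y\<close> at \<open>y = s * R\<close>. Dividing
    by small \<open>s\<close> of either sign squeezes the mean to 0.\<close>
  have lower: "s * expectation R \<le> exp (s\<^sup>2 * v) - 1" for s
  proof -
    have "expectation (\<lambda>\<omega>. 1 + s * R \<omega>) \<le> expectation (\<lambda>\<omega>. exp (s * R \<omega>))"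
      using int int_R by (intro integral_mono) auto
    also have "expectation (\<lambda>\<omega>. 1 + s * R \<omega>) = 1 + s * expectation R"
      using int_R by (simp add: prob_space)
    finally show ?thesis by (simp add: mgf)
  qed
  have lim0: "(\<lambda>n. (exp ((1 / real (Suc n))\<^sup>2 * v) - 1) * real (Suc n)) \<longlonglongrightarrow> 0"
    by real_asymp
  have "expectation R \<le> 0"
  proof (rule LIMSEQ_le_const[OF lim0], intro exI allI impI)
    fix n
    show "expectation R \<le> (exp ((1 / real (Suc n))\<^sup>2 * v) - 1) * real (Suc n)"
      using lower[of "1 / real (Suc n)"] by (simp add: field_simps)
  qed
  moreover have "- expectation R \<le> 0"
  proof (rule LIMSEQ_le_const[OF lim0], intro exI allI impI)
    fix n
    show "- expectation R \<le> (exp ((1 / real (Suc n))\<^sup>2 * v) - 1) * real (Suc n)"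
      using lower[of "- 1 / real (Suc n)"] by (simp add: field_simps)
  qed
  ultimately show "expectation R = 0" by simp
  \<comment> \<open>The second difference quotient at 0 of \<open>exp (s * R)\<close> in
    \<open>s\<close>, with step \<open>1 / real (Suc n)\<close>; \<open>Suc\<close> keeps the step
    meaningful at \<open>n = 0\<close>.\<close>
  define f where "f n \<omega> = (real (Suc n))\<^sup>2 * (exp (R \<omega> / real (Suc n)) + exp (- (R \<omega> / real (Suc n))) - 2)"
    for n \<omega>
  have f_expectation: "expectation (f n) = (real (Suc n))\<^sup>2 * (2 * exp ((1 / real (Suc n))\<^sup>2 * v) - 2)" for n
    using int[of "1 / real (Suc n)"] int[of "- 1 / real (Suc n)"]
      mgf[of "1 / real (Suc n)"] mgf[of "- 1 / real (Suc n)"]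
    by (simp add: f_def[abs_def] prob_space)
  have "(\<lambda>n. expectation (f n)) \<longlonglongrightarrow> expectation (\<lambda>\<omega>. (R \<omega>)\<^sup>2)"
  proof (rule integral_dominated_convergence)
    show "(\<lambda>\<omega>. (R \<omega>)\<^sup>2) \<in> borel_measurable M" "\<And>n. f n \<in> borel_measurable M"
      unfolding f_def[abs_def] by measurable
    \<comment> \<open>In the dominating function one factor \<open>exp \<bar>R\<bar>\<close> pays
      for the square of \<open>R\<close> and another for the exponential of the shrunken
      argument.\<close>
    show "integrable M (\<lambda>\<omega>. 2 * (exp (2 * R \<omega>) + exp (- (2 * R \<omega>))))"
      by (intro integrable_mult_right int2)
    have "(\<lambda>n. (real (Suc n))\<^sup>2 * (exp (y / real (Suc n)) + exp (- (y / real (Suc n))) - 2)) \<longlonglongrightarrow> y\<^sup>2"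
      for y :: real
      unfolding power2_eq_square[of y] by real_asymp
    then show "AE \<omega> in M. (\<lambda>n. f n \<omega>) \<longlonglongrightarrow> (R \<omega>)\<^sup>2"
      unfolding f_def by blast
    fix n
    have "norm (f n \<omega>) \<le> 2 * (exp (2 * R \<omega>) + exp (- (2 * R \<omega>)))" for \<omega>
    proof -
      let ?y = "R \<omega> / real (Suc n)"
      have "norm (f n \<omega>) = f n \<omega>"
        unfolding f_def using exp_add_exp_minus_le(1)[of ?y] by simp
      also have "\<dots> \<le> (real (Suc n))\<^sup>2 * (?y\<^sup>2 * exp \<bar>?y\<bar>)"
        unfolding f_def by (intro mult_left_mono exp_add_exp_minus_le(2)) simp
      also have "\<dots> = (R \<omega>)\<^sup>2 * exp \<bar>?y\<bar>"
        by (simp add: power_divide)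
      also have "\<dots> \<le> (2 * exp \<bar>R \<omega>\<bar>) * exp \<bar>R \<omega>\<bar>"
        using divide_left_mono[of 1 "real (Suc n)" "\<bar>R \<omega>\<bar>"]
        by (intro mult_mono square_le_exp_abs) (auto simp: abs_divide)
      also have "\<dots> = 2 * exp \<bar>2 * R \<omega>\<bar>"
        by (simp add: abs_mult flip: exp_add)
      also have "\<dots> \<le> 2 * (exp (2 * R \<omega>) + exp (- (2 * R \<omega>)))"
        using exp_abs[of "2 * R \<omega>"] by simp
      finally show ?thesis .
    qed
    then show "AE \<omega> in M. norm (f n \<omega>) \<le> 2 * (exp (2 * R \<omega>) + exp (- (2 * R \<omega>)))"
      by simp
  qed
  moreover have "(\<lambda>n. (real (Suc n))\<^sup>2 * (2 * exp ((1 / real (Suc n))\<^sup>2 * v) - 2)) \<longlonglongrightarrow> 2 * v"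
    by real_asymp
  ultimately show "expectation (\<lambda>\<omega>. (R \<omega>)\<^sup>2) = 2 * v"
    unfolding f_expectation by (rule LIMSEQ_unique)
qed

lemma complex_gaussian_real_moments:
  fixes X :: "'a \<Rightarrow> complex ^ 'n"
  assumes "complex_gaussian M X B"
  shows "integrable M (\<lambda>\<omega>. X \<omega> \<bullet> w)" and "expectation (\<lambda>\<omega>. X \<omega> \<bullet> w) = 0"
    and "integrable M (\<lambda>\<omega>. (X \<omega> \<bullet> w)\<^sup>2)"
    and "expectation (\<lambda>\<omega>. (X \<omega> \<bullet> w)\<^sup>2) = w \<bullet> (B *v w) / 2"
proof -
  have [measurable]: "X \<in> borel_measurable M"
    using assms by (rule complex_gaussian_measurable)
  have *: "has_bochner_integral M (\<lambda>\<omega>. exp (s * (X \<omega> \<bullet> w))) (exp (s\<^sup>2 * (w \<bullet> (B *v w) / 4)))" for s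
  proof (rule has_bochner_integral_nn_integral)
    \<comment> \<open>The vector \<open>(s / 2) *\<^sub>R w\<close> compensates the factor 2 in the
      exponent of \<open>complex_gaussian_mgf\<close> and produces the quarter.\<close>
    have "(\<integral>\<^sup>+\<omega>. ennreal (exp (2 * (X \<omega> \<bullet> ((s / 2) *\<^sub>R w)))) \<partial>M)
        = ennreal (exp (((s / 2) *\<^sub>R w) \<bullet> (B *v ((s / 2) *\<^sub>R w))))"
      by (rule complex_gaussian_mgf[OF prob_space_axioms assms])
    then show "(\<integral>\<^sup>+\<omega>. ennreal (exp (s * (X \<omega> \<bullet> w))) \<partial>M) = ennreal (exp (s\<^sup>2 * (w \<bullet> (B *v w) / 4)))"
      by (simp add: linear_scale[OF bounded_linear.linear[OF matrix_vector_mul_bounded_linear]]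
          power2_eq_square field_simps)
  qed auto
  have meas: "(\<lambda>\<omega>. X \<omega> \<bullet> w) \<in> borel_measurable M"
    by measurable
  have mgf: "integrable M (\<lambda>\<omega>. exp (s * (X \<omega> \<bullet> w)))"
    "expectation (\<lambda>\<omega>. exp (s * (X \<omega> \<bullet> w))) = exp (s\<^sup>2 * (w \<bullet> (B *v w) / 4))" for s
    using *[of s] by (simp_all only: has_bochner_integral_iff)
  note m = moments_of_mgf[OF meas mgf]
  show "integrable M (\<lambda>\<omega>. X \<omega> \<bullet> w)" "expectation (\<lambda>\<omega>. X \<omega> \<bullet> w) = 0"
    "integrable M (\<lambda>\<omega>. (X \<omega> \<bullet> w)\<^sup>2)"
    by (fact m)+
  show "expectation (\<lambda>\<omega>. (X \<omega> \<bullet> w)\<^sup>2) = w \<bullet> (B *v w) / 2"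
    using m(4) by simp
qed
text \<open>Polarisation of the quadratic moments; the Hermitian symmetry of \<open>B\<close> merges
  the two cross terms.\<close>

lemma complex_gaussian_mixed_moments:
  fixes X :: "'a \<Rightarrow> complex ^ 'n"
  assumes "complex_gaussian M X B"
  shows "integrable M (\<lambda>\<omega>. (X \<omega> \<bullet> u) * (X \<omega> \<bullet> w))"
    and "expectation (\<lambda>\<omega>. (X \<omega> \<bullet> u) * (X \<omega> \<bullet> w)) = u \<bullet> (B *v w) / 2"
proof -
  note mom = complex_gaussian_real_moments[OF assms]
  have eq: "(\<lambda>\<omega>. (X \<omega> \<bullet> u) * (X \<omega> \<bullet> w)) = (\<lambda>\<omega>. ((X \<omega> \<bullet> (u + w))\<^sup>2 - (X \<omega> \<bullet> u)\<^sup>2 - (X \<omega> \<bullet> w)\<^sup>2) / 2)"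
    by (simp add: inner_add_right power2_sum)
  show "integrable M (\<lambda>\<omega>. (X \<omega> \<bullet> u) * (X \<omega> \<bullet> w))"
    unfolding eq by (intro integrable_divide Bochner_Integration.integrable_diff mom)
  have sym: "w \<bullet> (B *v u) = u \<bullet> (B *v w)"
    using assms hermitian_matrix_inner[of B w u]
    by (auto simp: complex_gaussian_def pos_def_hermitian_def inner_commute)
  show "expectation (\<lambda>\<omega>. (X \<omega> \<bullet> u) * (X \<omega> \<bullet> w)) = u \<bullet> (B *v w) / 2"
  proof -
    have "expectation (\<lambda>\<omega>. (X \<omega> \<bullet> u) * (X \<omega> \<bullet> w))
        = ((u + w) \<bullet> (B *v (u + w)) / 2 - u \<bullet> (B *v u) / 2 - w \<bullet> (B *v w) / 2) / 2"
      unfolding eq by (simp add: mom del: inner_add_right inner_add_left)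
    then show ?thesis
      by (simp add: matrix_vector_right_distrib inner_add_left inner_add_right sym field_simps)
  qed
qed

text \<open>Real and imaginary parts of a coordinate are inner products with \<open>axis i 1\<close>
  and \<open>axis i \<i>\<close>. A complex second moment thus combines four mixed real moments,
  whose factors 1/2 add up to a full entry of \<open>B\<close>.\<close>

lemma complex_gaussian_component_moments:
  fixes X :: "'a \<Rightarrow> complex ^ 'n"
  assumes "complex_gaussian M X B"
  shows "expectation (\<lambda>\<omega>. X \<omega> $ i) = 0"
    and "expectation (\<lambda>\<omega>. X \<omega> $ i * cnj (X \<omega> $ j)) = B $ i $ j"
    and "integrable M (\<lambda>\<omega>. (cmod (X \<omega> $ i))\<^sup>2)"
    and "expectation (\<lambda>\<omega>. (cmod (X \<omega> $ i))\<^sup>2) = Re (B $ i $ i)"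
proof -
  note mom = complex_gaussian_real_moments[OF assms]
  note mix = complex_gaussian_mixed_moments[OF assms]
  define a where "a i = (axis i 1 :: complex ^ 'n)" for i
  define b where "b i = (axis i \<i> :: complex ^ 'n)" for i
  have ab: "z \<bullet> a i = Re (z $ i)" "z \<bullet> b i = Im (z $ i)" for z i
    by (simp_all add: a_def b_def inner_axis inner_complex_def)
  have B: "(B *v a j) $ i = B $ i $ j" "(B *v b j) $ i = B $ i $ j * \<i>" for i j
    by (simp_all add: a_def b_def matrix_vector_mult_def axis_def
        if_distrib cong: if_cong)
  have herm: "a i \<bullet> (B *v a j) = Re (B $ i $ j)" "b i \<bullet> (B *v b j) = Re (B $ i $ j)"
    "b i \<bullet> (B *v a j) = Im (B $ i $ j)" "a i \<bullet> (B *v b j) = - Im (B $ i $ j)" for i j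
    by (simp_all add: inner_commute[of "a _"] inner_commute[of "b _"] ab B)
  have "(\<lambda>\<omega>. X \<omega> $ i) = (\<lambda>\<omega>. complex_of_real (X \<omega> \<bullet> a i) + \<i> * complex_of_real (X \<omega> \<bullet> b i))"
    unfolding ab by (simp add: complex_eq_iff fun_eq_iff)
  then show "expectation (\<lambda>\<omega>. X \<omega> $ i) = 0"
    by (simp add: mom integral_add)
  have "(\<lambda>\<omega>. X \<omega> $ i * cnj (X \<omega> $ j)) =
    (\<lambda>\<omega>. complex_of_real ((X \<omega> \<bullet> a i) * (X \<omega> \<bullet> a j) + (X \<omega> \<bullet> b i) * (X \<omega> \<bullet> b j)) +
      \<i> * complex_of_real ((X \<omega> \<bullet> b i) * (X \<omega> \<bullet> a j) - (X \<omega> \<bullet> a i) * (X \<omega> \<bullet> b j)))"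
    unfolding ab by (simp add: complex_eq_iff fun_eq_iff)
  moreover have "integrable M (\<lambda>\<omega>. (X \<omega> \<bullet> a i) * (X \<omega> \<bullet> a j) + (X \<omega> \<bullet> b i) * (X \<omega> \<bullet> b j))"
    "integrable M (\<lambda>\<omega>. (X \<omega> \<bullet> b i) * (X \<omega> \<bullet> a j) - (X \<omega> \<bullet> a i) * (X \<omega> \<bullet> b j))"
    by (intro Bochner_Integration.integrable_add Bochner_Integration.integrable_diff mix)+
  ultimately have "expectation (\<lambda>\<omega>. X \<omega> $ i * cnj (X \<omega> $ j)) =
      complex_of_real (Re (B $ i $ j)) + \<i> * complex_of_real (Im (B $ i $ j))"
    by (simp add: mix herm del: of_real_add of_real_diff of_real_mult)
  then show "expectation (\<lambda>\<omega>. X \<omega> $ i * cnj (X \<omega> $ j)) = B $ i $ j"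
    by (simp add: complex_eq_iff)
  have sq: "(\<lambda>\<omega>. (cmod (X \<omega> $ i))\<^sup>2) = (\<lambda>\<omega>. (X \<omega> \<bullet> a i)\<^sup>2 + (X \<omega> \<bullet> b i)\<^sup>2)"
    unfolding ab by (simp add: cmod_power2)
  show "integrable M (\<lambda>\<omega>. (cmod (X \<omega> $ i))\<^sup>2)"
    unfolding sq by (intro Bochner_Integration.integrable_add mom)
  show "expectation (\<lambda>\<omega>. (cmod (X \<omega> $ i))\<^sup>2) = Re (B $ i $ i)"
    unfolding sq by (simp add: mom herm)
qed

lemma complex_gaussian_cvar:
  assumes "complex_gaussian M X B"
  shows "cvar M (\<lambda>\<omega>. X \<omega> $ i) = Re (B $ i $ i)"
  by (simp add: cvar_def complex_gaussian_component_moments[OF assms])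

lemma complex_gaussian_corr_matrix:
  assumes "complex_gaussian M X B"
  shows "corr_matrix M X = normalized_matrix B"
  unfolding normalized_matrix_def corr_matrix_def ccov_def complex_gaussian_cvar[OF assms]
    complex_gaussian_component_moments(1)[OF assms] diff_0_right
    complex_gaussian_component_moments(2)[OF assms] ..

end

section \<open>Polydisc probabilities\<close>

lemma norm_mult_le_op_norm: "norm (A *v z) \<le> op_norm A * norm z"
  unfolding op_norm_def by (rule onorm) (rule matrix_vector_mul_bounded_linear)

lemma op_norm_nonneg: "0 \<le> op_norm A"
  unfolding op_norm_def by (rule onorm_pos_le) (rule matrix_vector_mul_bounded_linear)

lemma inner_mult_le_op_norm: "z \<bullet> (A *v z) \<le> op_norm A * (norm z)\<^sup>2"
proof -
  have "z \<bullet> (A *v z) \<le> norm z * norm (A *v z)"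
    by (rule norm_cauchy_schwarz)
  also have "\<dots> \<le> norm z * (op_norm A * norm z)"
    by (intro mult_left_mono norm_mult_le_op_norm) simp
  finally show ?thesis by (simp add: power2_eq_square ac_simps)
qed

lemma pos_def_hermitian_op_norm_pos:
  assumes "pos_def_hermitian A"
  shows "0 < op_norm A"
proof -
  let ?e = "axis undefined 1 :: complex ^ 'a"
  have "?e \<noteq> 0" by simp
  then have "0 < ?e \<bullet> (A *v ?e)"
    using assms pos_def_hermitian_iff by blast
  also have "\<dots> \<le> op_norm A * (norm ?e)\<^sup>2"
    by (rule inner_mult_le_op_norm)
  finally show ?thesis by simp
qed

text \<open>Instead of diagonalising \<open>A\<close>, expand the nonnegative form of
  \<open>A\<close> at \<open>y - r *\<^sub>R z\<close>, where \<open>A *v y = z\<close>. The value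
  \<open>r = 1 / op_norm A\<close> is the best one once \<open>z \<bullet> (A *v z)\<close> is
  bounded by the operator norm.\<close>

lemma inner_matrix_inv_ge:
  assumes "pos_def_hermitian A"
  shows "(norm z)\<^sup>2 / op_norm A \<le> z \<bullet> (matrix_inv A *v z)"
proof -
  define y where "y = matrix_inv A *v z"
  define r where "r = 1 / op_norm A"
  have Ay: "A *v y = z"
    by (simp add: y_def matrix_vector_mul_assoc pos_def_hermitian_matrix_inv[OF assms])
  have herm: "hermitian_matrix A"
    using assms by (simp add: pos_def_hermitian_def)
  have pos: "0 < op_norm A"
    by (rule pos_def_hermitian_op_norm_pos[OF assms])
  have "0 \<le> (y - r *\<^sub>R z) \<bullet> (A *v (y - r *\<^sub>R z))"
    using assms by (cases "y - r *\<^sub>R z = 0") (auto simp: pos_def_hermitian_iff less_imp_le)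
  also have "\<dots> = y \<bullet> z - 2 * r * (z \<bullet> z) + r\<^sup>2 * (z \<bullet> (A *v z))"
  proof -
    have e1: "A *v (y - r *\<^sub>R z) = z - r *\<^sub>R (A *v z)"
      by (simp add: matrix_vector_mult_diff_distrib Ay
          linear_scale[OF bounded_linear.linear[OF matrix_vector_mul_bounded_linear]])
    have e2: "y \<bullet> (A *v z) = z \<bullet> z"
      using hermitian_matrix_inner[OF herm, of y z] by (simp add: Ay)
    show ?thesis
      unfolding e1 by (simp add: inner_diff_left inner_diff_right e2 power2_eq_square algebra_simps)
  qed
  also have "\<dots> \<le> y \<bullet> z - 2 * r * (z \<bullet> z) + r\<^sup>2 * (op_norm A * (norm z)\<^sup>2)"
    by (intro add_left_mono mult_left_mono inner_mult_le_op_norm) simp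
  also have "\<dots> = y \<bullet> z - (norm z)\<^sup>2 / op_norm A"
    using pos by (simp add: r_def power2_norm_eq_inner power_divide field_simps)
       (simp add: power2_eq_square)
  finally show ?thesis
    by (simp add: y_def inner_commute)
qed

section \<open>Normalisation by the diagonal of the covariance matrix\<close>

definition scale_vec :: "('n \<Rightarrow> real) \<Rightarrow> complex ^ 'n \<Rightarrow> complex ^ 'n"
  where "scale_vec r z = (\<chi> i. r i *\<^sub>R z $ i)"

text \<open>With \<open>D\<close> the diagonal part of \<open>B\<close>, these are the entries of
  D^(-1/2). \<open>scale_vec\<close> applies this diagonal matrix, and
  \<open>normalized_matrix B\<close> is D^(-1/2) B D^(-1/2).\<close>

definition inv_sqrt_diag :: "complex ^ 'n ^ 'n \<Rightarrow> 'n \<Rightarrow> real"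
  where "inv_sqrt_diag B i = 1 / sqrt (Re (B $ i $ i))"

lemma scale_vec_inner: "scale_vec r z \<bullet> w = z \<bullet> scale_vec r w"
  by (simp add: scale_vec_def inner_vec_def)

lemma scale_vec_scale_vec:
  assumes "\<And>i. r i * s i = 1"
  shows "scale_vec r (scale_vec s z) = z"
  using assms by (simp add: scale_vec_def vec_eq_iff)

lemma norm_vec_square: "(norm (z :: complex ^ 'n))\<^sup>2 = (\<Sum>i\<in>UNIV. (cmod (z $ i))\<^sup>2)"
  by (simp add: power2_norm_eq_inner inner_vec_def)

lemma pos_def_hermitian_diag_pos:
  assumes "pos_def_hermitian B"
  shows "0 < Re (B $ i $ i)"
proof -
  let ?e = "axis i 1 :: complex ^ 'a"
  have "0 < ?e \<bullet> (B *v ?e)"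
    using assms by (auto simp: pos_def_hermitian_iff)
  also have "?e \<bullet> (B *v ?e) = Re ((B *v ?e) $ i)"
    by (simp add: inner_axis' inner_complex_def)
  also have "(B *v ?e) $ i = B $ i $ i"
    by (simp add: matrix_vector_mult_def axis_def if_distrib cong: if_cong)
  finally show ?thesis .
qed

context
  fixes B :: "complex ^ 'n ^ 'n"
  assumes pd: "pos_def_hermitian B"
begin

lemma inv_sqrt_diag_pos: "0 < inv_sqrt_diag B i"
  using pos_def_hermitian_diag_pos[OF pd] by (simp add: inv_sqrt_diag_def)

lemma inv_sqrt_diag_square: "(inv_sqrt_diag B i)\<^sup>2 = 1 / Re (B $ i $ i)"
  using pos_def_hermitian_diag_pos[OF pd, of i] by (simp add: inv_sqrt_diag_def power_divide)

lemma normalized_matrix_mult: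
  "normalized_matrix B *v z = scale_vec (inv_sqrt_diag B) (B *v scale_vec (inv_sqrt_diag B) z)"
  by (simp add: normalized_matrix_def scale_vec_def inv_sqrt_diag_def matrix_vector_mult_def
      vec_eq_iff real_sqrt_mult scaleR_conv_of_real sum_divide_distrib ac_simps)

lemma normalized_matrix_diag: "normalized_matrix B $ i $ i = 1"
proof -
  have "B $ i $ i = cnj (B $ i $ i)"
    using pd unfolding pos_def_hermitian_def hermitian_matrix_def by blast
  then have "B $ i $ i = complex_of_real (Re (B $ i $ i))"
    by (simp add: complex_eq_iff)
  then show ?thesis
    using pos_def_hermitian_diag_pos[OF pd, of i]
    by (simp add: normalized_matrix_def) (metis divide_self less_irrefl of_real_eq_0_iff)
qed

lemma pos_def_hermitian_normalized: "pos_def_hermitian (normalized_matrix B)"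
  unfolding pos_def_hermitian_iff
proof (intro conjI allI impI)
  show "hermitian_matrix (normalized_matrix B)"
    unfolding hermitian_matrix_def
  proof (intro allI)
    fix i j
    have "cnj (B $ j $ i) = B $ i $ j"
      using pd unfolding pos_def_hermitian_def hermitian_matrix_def by metis
    then show "normalized_matrix B $ i $ j = cnj (normalized_matrix B $ j $ i)"
      by (simp add: normalized_matrix_def mult.commute)
  qed
  fix z :: "complex ^ 'n" assume "z \<noteq> 0"
  then have "scale_vec (inv_sqrt_diag B) z \<noteq> 0"
    using inv_sqrt_diag_pos by (auto simp: scale_vec_def vec_eq_iff less_le)
  then show "0 < z \<bullet> (normalized_matrix B *v z)"
    using pd unfolding normalized_matrix_mult scale_vec_inner[symmetric] pos_def_hermitian_iff
    by blast
qed

text \<open>The inverse of the normalised matrix is D^(1/2) B^(-1) D^(1/2), and \<open>s\<close>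
  holds the entries of D^(1/2). This change of variables makes the exponent of the density
  accessible to the norms of the correlation matrix and of its inverse.\<close>

lemma inner_matrix_inv_normalized:
  "z \<bullet> (matrix_inv B *v z) =
    scale_vec (inv_sqrt_diag B) z \<bullet> (matrix_inv (normalized_matrix B) *v scale_vec (inv_sqrt_diag B) z)"
proof -
  define s where "s i = sqrt (Re (B $ i $ i))" for i
  define y where "y = matrix_inv B *v z"
  note diag_pos = pos_def_hermitian_diag_pos[OF pd]
  have z: "z = B *v y"
    by (simp add: y_def matrix_vector_mul_assoc pos_def_hermitian_matrix_inv[OF pd])
  have one: "inv_sqrt_diag B i * s i = 1" for i
    using diag_pos[of i] by (simp add: inv_sqrt_diag_def s_def)
  have *: "scale_vec (inv_sqrt_diag B) z = normalized_matrix B *v scale_vec s y"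
    by (simp add: normalized_matrix_mult scale_vec_scale_vec[OF one] z)
  have "matrix_inv (normalized_matrix B) *v scale_vec (inv_sqrt_diag B) z = scale_vec s y"
    unfolding * by (simp add: matrix_vector_mul_assoc
        pos_def_hermitian_matrix_inv[OF pos_def_hermitian_normalized])
  then show ?thesis
    by (simp add: scale_vec_inner scale_vec_scale_vec[OF one]) (simp add: y_def)
qed

lemma norm_scale_vec_square:
  "(norm (scale_vec (inv_sqrt_diag B) z))\<^sup>2 = (\<Sum>i\<in>UNIV. (cmod (z $ i))\<^sup>2 / Re (B $ i $ i))"
  by (simp add: norm_vec_square scale_vec_def power_mult_distrib inv_sqrt_diag_square)

end

lemma ennreal_exp_neg_sum:
  assumes "finite I"
  shows "ennreal (exp (- (\<Sum>i\<in>I. f i))) = (\<Prod>i\<in>I. ennreal (exp (- f i)))"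
  using assms by (simp add: exp_sum prod_ennreal flip: sum_negf)

text \<open>The upper bound \<open>q_le\<close>, integrated over the whole space, limits the
  constant \<open>\<kappa>\<close>; the lower bound \<open>q_ge\<close>, integrated over the discs,
  limits the event. The factors \<open>pi * v i\<close> cancel, which leaves \<open>L * L'\<close>
  for every coordinate and \<open>\<mu>\<close> for each coordinate in \<open>K\<close>.\<close>

lemma (in prob_space) complex_gaussian_small_ball:
  fixes X :: "'a \<Rightarrow> complex ^ 'n"
  assumes g: "complex_gaussian M X B"
  defines "C \<equiv> normalized_matrix B"
  shows "prob {\<omega> \<in> space M. \<forall>i\<in>K. (cmod (X \<omega> $ i))\<^sup>2 < x\<^sup>2 * Re (B $ i $ i)}
    \<le> (op_norm C * op_norm (matrix_inv C)) ^ CARD('n) * (1 - exp (- (x\<^sup>2 / op_norm C))) ^ card K"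
proof -
  have pd: "pos_def_hermitian B"
    using g by (simp add: complex_gaussian_def)
  have pdC: "pos_def_hermitian C"
    unfolding C_def by (rule pos_def_hermitian_normalized[OF pd])
  define v where "v i = Re (B $ i $ i)" for i
  define L where "L = op_norm C"
  define L' where "L' = op_norm (matrix_inv C)"
  define \<mu> where "\<mu> = 1 - exp (- (x\<^sup>2 / L))"
  define q where "q z = z \<bullet> (matrix_inv B *v z)" for z
  have v: "0 < v i" for i
    unfolding v_def by (rule pos_def_hermitian_diag_pos[OF pd])
  have L: "0 < L"
    unfolding L_def by (rule pos_def_hermitian_op_norm_pos[OF pdC])
  have \<mu>: "0 \<le> \<mu>"
    using L by (simp add: \<mu>_def)
  have q_ge: "(\<Sum>i\<in>UNIV. 1 / (L * v i) * (cmod (z $ i))\<^sup>2) \<le> q z" for z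
    using inner_matrix_inv_ge[OF pdC, of "scale_vec (inv_sqrt_diag B) z"]
    by (simp add: q_def inner_matrix_inv_normalized[OF pd] norm_scale_vec_square[OF pd]
        sum_divide_distrib L_def v_def C_def mult.commute)
  have q_le: "q z \<le> (\<Sum>i\<in>UNIV. L' / v i * (cmod (z $ i))\<^sup>2)" for z
    using inner_mult_le_op_norm[of "scale_vec (inv_sqrt_diag B) z" "matrix_inv C"]
    by (simp add: q_def inner_matrix_inv_normalized[OF pd] norm_scale_vec_square[OF pd]
        sum_distrib_left L'_def v_def C_def)
  \<comment> \<open>\<open>L' = 0\<close> would force \<open>q \<le> 0\<close> everywhere, while
    \<open>q_ge\<close> makes \<open>q\<close> positive at a unit vector.\<close>
  have L': "0 < L'"
  proof (rule ccontr)
    assume "\<not> 0 < L'"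
    then have "L' = 0"
      using op_norm_nonneg[of "matrix_inv C"] by (simp add: L'_def)
    then have "q (axis undefined 1) \<le> 0"
      using q_le by (metis (no_types, lifting) div_0 mult_zero_left sum.neutral)
    moreover have "0 < (\<Sum>i\<in>UNIV. 1 / (L * v i) * (cmod ((axis undefined 1 :: complex ^ 'n) $ i))\<^sup>2)"
      by (rule sum_pos2[of _ undefined]) (use L v in \<open>auto simp: less_imp_le\<close>)
    ultimately show False
      using q_ge[of "axis undefined 1"] by linarith
  qed
  obtain \<kappa> where \<kappa>: "0 < \<kappa>"
    and total: "ennreal \<kappa> * (\<integral>\<^sup>+z. ennreal (exp (- q z)) \<partial>lborel) = 1"
    and nn: "\<forall>f\<in>borel_measurable borel. (\<integral>\<^sup>+\<omega>. f (X \<omega>) \<partial>M)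
      = ennreal \<kappa> * (\<integral>\<^sup>+z. ennreal (exp (- q z)) * f z \<partial>lborel)"
    unfolding q_def using complex_gaussian_nn_integral[OF prob_space_axioms g] by blast
  have [measurable]: "X \<in> borel_measurable M"
    using g by (rule complex_gaussian_measurable)
  \<comment> \<open>By \<open>q_le\<close> a product of one-variable Gaussians lies below the
    exponential in the density, so \<open>\<kappa>\<close> times its integral is at most 1.\<close>
  have "ennreal (\<kappa> * (\<Prod>i\<in>UNIV. pi * v i) / L' ^ CARD('n))
      = ennreal \<kappa> * (\<Prod>i\<in>UNIV. ennreal (pi / (L' / v i)))"
    using \<kappa> v L' by (simp add: prod_ennreal ennreal_mult'[symmetric] prod_dividef less_imp_le)
  also have "\<dots> = ennreal \<kappa> * (\<Prod>i\<in>UNIV. \<integral>\<^sup>+z. ennreal (exp (- (L' / v i * (cmod z)\<^sup>2))) \<partial>lborel)"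
    using v L' by (subst nn_integral_exp_cmod_square) auto
  also have "\<dots> = ennreal \<kappa> * (\<integral>\<^sup>+z. (\<Prod>i\<in>UNIV. ennreal (exp (- (L' / v i * (cmod (z $ i))\<^sup>2)))) \<partial>(lborel :: (complex ^ 'n) measure))"
    by (subst nn_integral_lborel_vec_prod) auto
  also have "\<dots> \<le> ennreal \<kappa> * (\<integral>\<^sup>+z. ennreal (exp (- q z)) \<partial>lborel)"
    unfolding ennreal_exp_neg_sum[OF finite, symmetric] using q_le by (intro mult_left_mono nn_integral_mono ennreal_leI) auto
  finally have "ennreal (\<kappa> * (\<Prod>i\<in>UNIV. pi * v i) / L' ^ CARD('n)) \<le> 1"
    unfolding total .
  then have \<kappa>_le: "\<kappa> * (\<Prod>i\<in>UNIV. pi * v i) \<le> L' ^ CARD('n)"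
    using L' by (simp add: field_simps)

  \<comment> \<open>Closed discs cover the strict inequalities of the event; the whole plane outside
    \<open>K\<close> lets one product formula treat all coordinates.\<close>
  define D where "D i = (if i \<in> K then {z. (cmod z)\<^sup>2 \<le> x\<^sup>2 * v i} else UNIV)" for i
  have [measurable]: "D i \<in> sets borel" for i
    unfolding D_def by auto
  have disc: "(\<integral>\<^sup>+z. ennreal (exp (- (1 / (L * v i) * (cmod z)\<^sup>2))) * indicator (D i) z \<partial>lborel)
      = ennreal (pi * v i * L * (if i \<in> K then \<mu> else 1))" for i
  proof (cases "i \<in> K")
    case True
    then show ?thesis
      using v[of i] L nn_integral_exp_cmod_square_disc[of "1 / (L * v i)" "x\<^sup>2 * v i"]
      by (simp add: D_def \<mu>_def ac_simps)
  next
    case False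
    then show ?thesis
      using v[of i] L nn_integral_exp_cmod_square[of "1 / (L * v i)"] by (simp add: D_def ac_simps)
  qed
  have "emeasure M {\<omega> \<in> space M. \<forall>i\<in>K. (cmod (X \<omega> $ i))\<^sup>2 < x\<^sup>2 * Re (B $ i $ i)}
      \<le> (\<integral>\<^sup>+\<omega>. (\<Prod>i\<in>UNIV. indicator (D i) (X \<omega> $ i)) \<partial>M)"
  proof (subst nn_integral_indicator[symmetric])
    show "{\<omega> \<in> space M. \<forall>i\<in>K. (cmod (X \<omega> $ i))\<^sup>2 < x\<^sup>2 * Re (B $ i $ i)} \<in> sets M"
      by measurable
    show "(\<integral>\<^sup>+\<omega>. indicator {\<omega> \<in> space M. \<forall>i\<in>K. (cmod (X \<omega> $ i))\<^sup>2 < x\<^sup>2 * Re (B $ i $ i)} \<omega> \<partial>M)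
        \<le> (\<integral>\<^sup>+\<omega>. (\<Prod>i\<in>UNIV. indicator (D i) (X \<omega> $ i)) \<partial>M)"
      by (intro nn_integral_mono) (auto simp: D_def v_def less_imp_le split: split_indicator)
  qed
  also have "\<dots> = ennreal \<kappa> * (\<integral>\<^sup>+z. ennreal (exp (- q z)) * (\<Prod>i\<in>UNIV. indicator (D i) (z $ i)) \<partial>lborel)"
    using nn by (rule bspec) measurable
  also have "\<dots> \<le> ennreal \<kappa> * (\<integral>\<^sup>+z. (\<Prod>i\<in>UNIV. ennreal (exp (- (1 / (L * v i) * (cmod (z $ i))\<^sup>2))) * indicator (D i) (z $ i)) \<partial>lborel)"
    unfolding prod.distrib ennreal_exp_neg_sum[OF finite, symmetric]
    using q_ge by (intro mult_left_mono mult_right_mono nn_integral_mono ennreal_leI) auto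
  also have "\<dots> = ennreal \<kappa> * (\<Prod>i\<in>UNIV. ennreal (pi * v i * L * (if i \<in> K then \<mu> else 1)))"
    unfolding disc[symmetric]
    by (subst nn_integral_lborel_vec_prod[where f = "\<lambda>i z. ennreal (exp (- (1 / (L * v i) * (cmod z)\<^sup>2))) * indicator (D i) z"])
       auto
  also have "\<dots> = ennreal (\<kappa> * (\<Prod>i\<in>UNIV. pi * v i * L * (if i \<in> K then \<mu> else 1)))"
    using \<kappa> v L \<mu> by (subst prod_ennreal) (auto simp: ennreal_mult'[symmetric] less_imp_le)
  also have "\<kappa> * (\<Prod>i\<in>UNIV. pi * v i * L * (if i \<in> K then \<mu> else 1))
      = (\<kappa> * (\<Prod>i\<in>UNIV. pi * v i)) * (L ^ CARD('n) * \<mu> ^ card K)"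
    by (simp add: prod.distrib prod.If_cases)
  also have "ennreal \<dots> \<le> ennreal (L' ^ CARD('n) * (L ^ CARD('n) * \<mu> ^ card K))"
    using \<kappa>_le L \<mu> by (intro ennreal_leI mult_right_mono) auto
  finally have "emeasure M {\<omega> \<in> space M. \<forall>i\<in>K. (cmod (X \<omega> $ i))\<^sup>2 < x\<^sup>2 * Re (B $ i $ i)}
      \<le> ennreal (L' ^ CARD('n) * (L ^ CARD('n) * \<mu> ^ card K))" .
  then have "prob {\<omega> \<in> space M. \<forall>i\<in>K. (cmod (X \<omega> $ i))\<^sup>2 < x\<^sup>2 * Re (B $ i $ i)}
      \<le> L' ^ CARD('n) * (L ^ CARD('n) * \<mu> ^ card K)"
    using L L' \<mu> by (simp add: emeasure_eq_measure)
  then show ?thesis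
    unfolding L_def L'_def \<mu>_def by (simp add: power_mult_distrib ac_simps)
qed

section \<open>Principal submatrices and exponential moments\<close>

text \<open>The orthogonal projection onto the vectors supported on \<open>J\<close>;
  \<open>submatrix_on J A\<close> is the compression of \<open>A\<close> by it.\<close>

definition restrict_vec :: "'n set \<Rightarrow> complex ^ 'n \<Rightarrow> complex ^ 'n"
  where "restrict_vec J z = (\<chi> i. if i \<in> J then z $ i else 0)"

lemma restrict_vec_inner: "restrict_vec J z \<bullet> w = z \<bullet> restrict_vec J w"
  by (auto simp: restrict_vec_def inner_vec_def intro!: sum.cong)

lemma restrict_vec_idem [simp]: "restrict_vec J (restrict_vec J z) = restrict_vec J z"
  by (simp add: restrict_vec_def vec_eq_iff)

lemma norm_restrict_vec_square: "(norm (restrict_vec J z))\<^sup>2 = (\<Sum>i\<in>J. (cmod (z $ i))\<^sup>2)"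
proof -
  have "(norm (restrict_vec J z))\<^sup>2 = (\<Sum>i\<in>UNIV. if i \<in> J then (cmod (z $ i))\<^sup>2 else 0)"
    unfolding norm_vec_square restrict_vec_def by (intro sum.cong) auto
  also have "\<dots> = (\<Sum>i\<in>J. (cmod (z $ i))\<^sup>2)"
    by (simp add: sum.If_cases)
  finally show ?thesis .
qed

lemma submatrix_on_mult:
  "submatrix_on J A *v z = restrict_vec J (A *v restrict_vec J z)"
  by (auto simp: submatrix_on_def restrict_vec_def matrix_vector_mult_def vec_eq_iff
      intro!: sum.cong)

lemma restrict_vec_quadratic_le:
  "restrict_vec J z \<bullet> (A *v restrict_vec J z) \<le> op_norm (submatrix_on J A) * (norm (restrict_vec J z))\<^sup>2"
  using inner_mult_le_op_norm[of "restrict_vec J z" "submatrix_on J A"]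
  by (simp add: submatrix_on_mult restrict_vec_inner)

text \<open>This shows that the choice in \<open>submatrix_inv\<close> has a witness.
  \<open>G\<close> is block diagonal, with the block of \<open>A\<close> on \<open>J\<close> and the
  identity on the complement. Its quadratic form splits accordingly, so it is positive definite, and
  the \<open>J\<close> block of its inverse is the witness.\<close>

lemma submatrix_on_mult_submatrix_inv:
  assumes "pos_def_hermitian A"
  shows "submatrix_on J A ** submatrix_inv J A = submatrix_on J (mat 1)"
proof -
  define G where "G = (\<chi> i j. if i \<in> J \<and> j \<in> J then A $ i $ j else if i = j then 1 else 0)"
  have G_mult: "G *v z = restrict_vec J (A *v restrict_vec J z) + restrict_vec (- J) z" for z
    unfolding vec_eq_iff
  proof
    fix i
    show "(G *v z) $ i = (restrict_vec J (A *v restrict_vec J z) + restrict_vec (- J) z) $ i"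
    proof (cases "i \<in> J")
      case True
      then have "(\<Sum>k\<in>UNIV. G $ i $ k * z $ k) = (\<Sum>k\<in>UNIV. A $ i $ k * restrict_vec J z $ k)"
        by (intro sum.cong) (auto simp: G_def restrict_vec_def)
      with True show ?thesis
        by (simp add: matrix_vector_mult_def restrict_vec_def[of _ "vec_lambda _"]
            restrict_vec_def[of "- J"])
    next
      case False
      then have "(\<Sum>k\<in>UNIV. G $ i $ k * z $ k) = (\<Sum>k\<in>UNIV. if k = i then z $ k else 0)"
        by (intro sum.cong) (auto simp: G_def)
      with False show ?thesis
        by (simp add: matrix_vector_mult_def restrict_vec_def)
    qed
  qed
  have "pos_def_hermitian G"
    unfolding pos_def_hermitian_iff
  proof (intro conjI allI impI)
    have "cnj (A $ j $ i) = A $ i $ j" for i j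
      using assms unfolding pos_def_hermitian_def hermitian_matrix_def by metis
    then show "hermitian_matrix G"
      unfolding hermitian_matrix_def G_def by auto
    fix z :: "complex ^ 'a" assume "z \<noteq> 0"
    have z: "z = restrict_vec J z + restrict_vec (- J) z"
      by (simp add: restrict_vec_def vec_eq_iff)
    have "z \<bullet> (G *v z) = restrict_vec J z \<bullet> (A *v restrict_vec J z) + restrict_vec (- J) z \<bullet> restrict_vec (- J) z"
      unfolding G_mult inner_add_right restrict_vec_inner[of _ z, symmetric]
      by (metis restrict_vec_idem restrict_vec_inner)
    moreover have "0 \<le> w \<bullet> (A *v w)" "w \<noteq> 0 \<Longrightarrow> 0 < w \<bullet> (A *v w)" for w
      using assms by (cases "w = 0"; simp add: pos_def_hermitian_iff less_imp_le)+
    moreover have "restrict_vec J z \<noteq> 0 \<or> restrict_vec (- J) z \<noteq> 0"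
      using z \<open>z \<noteq> 0\<close> by auto
    ultimately show "0 < z \<bullet> (G *v z)"
      by (metis add_nonneg_pos add_pos_nonneg inner_ge_zero inner_gt_zero_iff)
  qed
  then have inv: "G ** matrix_inv G = mat 1" "matrix_inv G ** G = mat 1"
    by (rule pos_def_hermitian_matrix_inv)+
  let ?H = "submatrix_on J (matrix_inv G)"
  have "submatrix_on J A ** ?H = submatrix_on J (mat 1)"
    unfolding vec_eq_iff
  proof (intro allI)
    fix i j
    have "(\<Sum>k\<in>UNIV. G $ i $ k * matrix_inv G $ k $ j) = mat 1 $ i $ j"
      unfolding inv(1)[symmetric] by (simp add: matrix_matrix_mult_def)
    \<comment> \<open>For \<open>i\<close> in \<open>J\<close> the row of \<open>G\<close> vanishes
      outside \<open>J\<close>, so only indices \<open>k\<close> in \<open>J\<close> contribute to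
      either sum.\<close>
    moreover have "(\<Sum>k\<in>UNIV. submatrix_on J A $ i $ k * ?H $ k $ j)
        = (\<Sum>k\<in>UNIV. G $ i $ k * matrix_inv G $ k $ j)" if "i \<in> J" "j \<in> J"
      using that by (intro sum.cong) (auto simp: submatrix_on_def G_def)
    ultimately show "(submatrix_on J A ** ?H) $ i $ j = submatrix_on J (mat 1) $ i $ j"
      by (cases "i \<in> J"; cases "j \<in> J") (simp_all add: matrix_matrix_mult_def submatrix_on_def)
  qed
  moreover have "?H ** submatrix_on J A = submatrix_on J (mat 1)"
    unfolding vec_eq_iff
  proof (intro allI)
    fix i j
    have "(\<Sum>k\<in>UNIV. matrix_inv G $ i $ k * G $ k $ j) = mat 1 $ i $ j"
      unfolding inv(2)[symmetric] by (simp add: matrix_matrix_mult_def)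
    moreover have "(\<Sum>k\<in>UNIV. ?H $ i $ k * submatrix_on J A $ k $ j)
        = (\<Sum>k\<in>UNIV. matrix_inv G $ i $ k * G $ k $ j)" if "i \<in> J" "j \<in> J"
      using that by (intro sum.cong) (auto simp: submatrix_on_def G_def)
    ultimately show "(?H ** submatrix_on J A) $ i $ j = submatrix_on J (mat 1) $ i $ j"
      by (cases "i \<in> J"; cases "j \<in> J") (simp_all add: matrix_matrix_mult_def submatrix_on_def)
  qed
  moreover have "submatrix_on J ?H = ?H"
    by (simp add: submatrix_on_def vec_eq_iff)
  ultimately have "\<exists>A'. submatrix_on J A' = A' \<and> submatrix_on J A ** A' = submatrix_on J (mat 1) \<and>
      A' ** submatrix_on J A = submatrix_on J (mat 1)"
    by blast
  from someI_ex[OF this]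
  show ?thesis
    unfolding submatrix_inv_def by blast
qed

text \<open>It turns a bound on the product of the two norms into a bound on the norm of the
  submatrix. For the basis vector \<open>e\<close> and its preimage \<open>y\<close>, the
  nonnegative form at \<open>e - y\<close> equals \<open>y \<bullet> e - 1\<close>, because the
  diagonal entry and \<open>e \<bullet> e\<close> are 1.\<close>

lemma op_norm_submatrix_inv_ge_1:
  assumes pd: "pos_def_hermitian A" and "i \<in> J" and diag: "A $ i $ i = 1"
  shows "1 \<le> op_norm (submatrix_inv J A)"
proof -
  define e where "e = (axis i 1 :: complex ^ 'a)"
  define y where "y = submatrix_inv J A *v e"
  let ?S = "submatrix_on J A"
  have re: "restrict_vec J e = e"
    using \<open>i \<in> J\<close> by (auto simp: restrict_vec_def e_def vec_eq_iff axis_def)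
  have Sy: "?S *v y = e"
    by (simp add: y_def matrix_vector_mul_assoc submatrix_on_mult_submatrix_inv[OF pd] submatrix_on_mult re)
  have herm: "hermitian_matrix A"
    using pd by (simp add: pos_def_hermitian_def)
  have S_inner: "z \<bullet> (?S *v w) = restrict_vec J z \<bullet> (A *v restrict_vec J w)" for z w
    by (simp add: submatrix_on_mult restrict_vec_inner)
  have S_sym: "e \<bullet> (?S *v y) = y \<bullet> (?S *v e)"
    unfolding S_inner using hermitian_matrix_inner[OF herm] by (metis inner_commute)
  have "(A *v e) $ i = 1"
    using diag by (simp add: e_def matrix_vector_mult_def axis_def if_distrib cong: if_cong)
  then have See: "e \<bullet> (?S *v e) = 1"
    unfolding S_inner re by (simp add: e_def inner_axis' inner_complex_def)
  have ee: "e \<bullet> e = 1"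
    by (simp add: e_def inner_axis')
  have "0 \<le> (e - y) \<bullet> (?S *v (e - y))"
    unfolding S_inner using pd by (cases "restrict_vec J (e - y) = 0")
      (auto simp: pos_def_hermitian_iff less_imp_le)
  also have "\<dots> = y \<bullet> e - 1"
    using S_sym
    by (simp add: matrix_vector_mult_diff_distrib inner_diff_left inner_diff_right See Sy ee)
  finally have "1 \<le> y \<bullet> e" by simp
  also have "\<dots> \<le> norm y * norm e"
    by (rule norm_cauchy_schwarz)
  also have "norm e = 1"
    using ee by (simp add: norm_eq_sqrt_inner)
  also have "norm y * 1 \<le> op_norm (submatrix_inv J A)"
    using norm_mult_le_op_norm[of "submatrix_inv J A" e] \<open>norm e = 1\<close> by (simp add: y_def)
  finally show ?thesis .
qed

text \<open>The square in the exponent is linearised by an auxiliary standard Gaussian vector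
  \<open>g\<close>, and Tonelli's theorem reduces the claim to the moment generating function of
  \<open>X\<close>.\<close>

lemma (in prob_space) complex_gaussian_exp_square_moment:
  fixes X :: "'a \<Rightarrow> complex ^ 'n"
  assumes g: "complex_gaussian M X B"
    and L: "op_norm (submatrix_on J (normalized_matrix B)) \<le> L" and "L < 2"
  shows "(\<integral>\<^sup>+\<omega>. ennreal (exp ((\<Sum>i\<in>J. (cmod (X \<omega> $ i))\<^sup>2 / Re (B $ i $ i)) / 2)) \<partial>M)
    \<le> ennreal ((1 / (1 - L / 2)) ^ card J)"
proof -
  have pd: "pos_def_hermitian B"
    using g by (simp add: complex_gaussian_def)
  have [measurable]: "X \<in> borel_measurable M"
    using g by (rule complex_gaussian_measurable)
  \<comment> \<open>The factor \<open>1 / sqrt 2\<close> makes \<open>u z \<bullet> u z\<close>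
    exactly the exponent of the claim; \<open>u\<close> is self-adjoint.\<close>
  define u where "u z = (1 / sqrt 2) *\<^sub>R scale_vec (inv_sqrt_diag B) (restrict_vec J z)" for z
  have u_nth: "u z $ i = (if i \<in> J then (inv_sqrt_diag B i / sqrt 2) *\<^sub>R z $ i else 0)" for z i
    by (simp add: u_def scale_vec_def restrict_vec_def)
  have u_adj: "g \<bullet> u z = z \<bullet> u g" for g z
    unfolding inner_vec_def u_nth by (auto simp: inner_commute intro!: sum.cong)
  have [measurable]: "u \<in> borel_measurable borel"
  proof -
    have "bounded_linear u"
      unfolding linear_conv_bounded_linear[symmetric]
      by (rule linearI) (auto simp: vec_eq_iff u_nth scaleR_right_distrib)
    then show ?thesis
      by (intro borel_measurable_continuous_onI linear_continuous_on)
  qed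
  have u_norm: "u z \<bullet> u z = (\<Sum>i\<in>J. (cmod (z $ i))\<^sup>2 / Re (B $ i $ i)) / 2" for z
  proof -
    have "u z \<bullet> u z = (\<Sum>i\<in>UNIV. if i \<in> J then (cmod (z $ i))\<^sup>2 / Re (B $ i $ i) / 2 else 0)"
      unfolding power2_norm_eq_inner[symmetric] norm_vec_square u_nth
      by (intro sum.cong) (simp_all add: power_mult_distrib power_divide inv_sqrt_diag_square[OF pd])
    also have "\<dots> = (\<Sum>i\<in>J. (cmod (z $ i))\<^sup>2 / Re (B $ i $ i)) / 2"
      by (simp add: sum.If_cases sum_divide_distrib)
    finally show ?thesis .
  qed
  have u_quad: "u g \<bullet> (B *v u g) \<le> L / 2 * (\<Sum>i\<in>J. (cmod (g $ i))\<^sup>2)" for g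
  proof -
    have "u g \<bullet> (B *v u g) = (restrict_vec J g \<bullet> (normalized_matrix B *v restrict_vec J g)) / 2"
      unfolding normalized_matrix_mult[OF pd]
      by (simp add: u_def scale_vec_inner[symmetric]
          linear_scale[OF bounded_linear.linear[OF matrix_vector_mul_bounded_linear]])
    also have "\<dots> \<le> op_norm (submatrix_on J (normalized_matrix B)) * (norm (restrict_vec J g))\<^sup>2 / 2"
      by (intro divide_right_mono restrict_vec_quadratic_le) simp
    also have "\<dots> \<le> L * (norm (restrict_vec J g))\<^sup>2 / 2"
      using L by (intro divide_right_mono mult_right_mono) auto
    finally show ?thesis by (simp add: norm_restrict_vec_square)
  qed
  have norm_sum: "g \<bullet> g = (\<Sum>i\<in>UNIV. 1 * (cmod (g $ i))\<^sup>2)" for g :: "complex ^ 'n"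
    by (simp add: norm_vec_square flip: power2_norm_eq_inner)
  have std: "(\<integral>\<^sup>+g. ennreal (exp (- (g \<bullet> g))) \<partial>(lborel :: (complex ^ 'n) measure)) = ennreal (pi ^ CARD('n))"
    unfolding norm_sum ennreal_exp_neg_sum[OF finite]
    by (subst nn_integral_lborel_vec_prod[where f = "\<lambda>i z. ennreal (exp (- (1 * (cmod z)\<^sup>2)))"])
       (auto simp: nn_integral_exp_cmod_square[of 1, simplified] ennreal_power)
  \<comment> \<open>The shift formula for the identity matrix and \<open>h = u z\<close>, read from
    right to left; self-adjointness moves \<open>u\<close> onto \<open>g\<close>.\<close>
  have lin: "ennreal (exp (u z \<bullet> u z)) * ennreal (pi ^ CARD('n))
      = (\<integral>\<^sup>+g. ennreal (exp (2 * (z \<bullet> u g))) * ennreal (exp (- (g \<bullet> g))) \<partial>lborel)" for z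
    using nn_integral_exp_quadratic_shift[of "mat 1" "u z"]
    by (simp add: std u_adj ennreal_mult'[symmetric] flip: exp_add)
  interpret pair_sigma_finite M "lborel :: (complex ^ 'n) measure" ..
  have "(\<integral>\<^sup>+\<omega>. ennreal (exp (u (X \<omega>) \<bullet> u (X \<omega>))) \<partial>M) * ennreal (pi ^ CARD('n))
      = (\<integral>\<^sup>+\<omega>. (\<integral>\<^sup>+g. ennreal (exp (2 * (X \<omega> \<bullet> u g))) * ennreal (exp (- (g \<bullet> g))) \<partial>lborel) \<partial>M)"
    by (subst nn_integral_multc[symmetric]) (simp_all add: lin)
  also have "\<dots> = (\<integral>\<^sup>+g. (\<integral>\<^sup>+\<omega>. ennreal (exp (2 * (X \<omega> \<bullet> u g))) * ennreal (exp (- (g \<bullet> g))) \<partial>M) \<partial>lborel)"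
    by (rule Fubini'[symmetric]) measurable
  also have "\<dots> = (\<integral>\<^sup>+g. ennreal (exp (u g \<bullet> (B *v u g))) * ennreal (exp (- (g \<bullet> g))) \<partial>lborel)"
    by (simp add: nn_integral_multc complex_gaussian_mgf[OF prob_space_axioms g])
  \<comment> \<open>Coordinates in \<open>J\<close> lose \<open>L / 2\<close> of their unit weight.
    What remains is positive by \<open>L < 2\<close>, so the one-variable integrals are
    finite.\<close>
  also have "\<dots> \<le> (\<integral>\<^sup>+g. (\<Prod>i\<in>UNIV. ennreal (exp (- ((if i \<in> J then 1 - L / 2 else 1) * (cmod (g $ i))\<^sup>2)))) \<partial>lborel)"
  proof (intro nn_integral_mono)
    fix g :: "complex ^ 'n"
    have "(\<Sum>i\<in>UNIV. (if i \<in> J then 1 - L / 2 else 1) * (cmod (g $ i))\<^sup>2)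
        = (\<Sum>i\<in>UNIV. 1 * (cmod (g $ i))\<^sup>2 - (if i \<in> J then L / 2 * (cmod (g $ i))\<^sup>2 else 0))"
      by (intro sum.cong) (auto simp: algebra_simps)
    also have "\<dots> = g \<bullet> g - L / 2 * (\<Sum>i\<in>J. (cmod (g $ i))\<^sup>2)"
      unfolding norm_sum sum_subtractf by (simp add: sum.If_cases sum_distrib_left)
    finally have *: "u g \<bullet> (B *v u g) - g \<bullet> g \<le> - (\<Sum>i\<in>UNIV. (if i \<in> J then 1 - L / 2 else 1) * (cmod (g $ i))\<^sup>2)"
      using u_quad[of g] by linarith
    have "ennreal (exp (u g \<bullet> (B *v u g))) * ennreal (exp (- (g \<bullet> g))) = ennreal (exp (u g \<bullet> (B *v u g) - g \<bullet> g))"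
      by (simp add: ennreal_mult'[symmetric] flip: exp_add)
    also have "\<dots> \<le> ennreal (exp (- (\<Sum>i\<in>UNIV. (if i \<in> J then 1 - L / 2 else 1) * (cmod (g $ i))\<^sup>2)))"
      using * by (intro ennreal_leI) simp
    finally show "ennreal (exp (u g \<bullet> (B *v u g))) * ennreal (exp (- (g \<bullet> g)))
        \<le> (\<Prod>i\<in>UNIV. ennreal (exp (- ((if i \<in> J then 1 - L / 2 else 1) * (cmod (g $ i))\<^sup>2))))"
      unfolding ennreal_exp_neg_sum[OF finite] .
  qed
  also have "\<dots> = (\<Prod>i\<in>UNIV. \<integral>\<^sup>+z. ennreal (exp (- ((if i \<in> J then 1 - L / 2 else 1) * (cmod z)\<^sup>2))) \<partial>lborel)"
    by (rule nn_integral_lborel_vec_prod) measurable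
  also have "\<dots> = (\<Prod>i\<in>UNIV. ennreal (pi / (if i \<in> J then 1 - L / 2 else 1)))"
    using \<open>L < 2\<close> by (intro prod.cong refl nn_integral_exp_cmod_square) auto
  also have "\<dots> = ennreal (\<Prod>i\<in>UNIV. pi * (if i \<in> J then 1 / (1 - L / 2) else 1))"
    using \<open>L < 2\<close> by (subst prod_ennreal) (auto intro!: arg_cong[where f = ennreal] prod.cong)
  also have "\<dots> = ennreal ((1 / (1 - L / 2)) ^ card J) * ennreal (pi ^ CARD('n))"
    using \<open>L < 2\<close> by (simp add: prod.distrib prod.If_cases ennreal_mult'[symmetric] mult.commute)
  finally show ?thesis
    unfolding u_norm by (simp add: ennreal_mult_le_mult_iff mult.commute[of _ "ennreal (pi ^ CARD('n))"])
qed

section \<open>A Chernoff bound for large conditional second moments\<close>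

lemma exp_numeric_bound: "exp (1 / 2 - exp 1 / 2) \<le> 1 - exp 1 / (5 :: real)"
proof -
  \<comment> \<open>The right-hand side is \<open>1 - c / 2\<close> at the extreme value
    \<open>c = 2 * exp 1 / 5\<close>. A lower bound 2.68 for e puts the exponent below -0.84, and
    exp(-0.84) is at most 10/22, about 0.4545; the upper bound 2.72 keeps the right-hand side above
    0.456.\<close>
  have e: "exp 1 < (272 / 100 :: real)"
    by (rule e_less_272)
  have "(268 / 100 :: real) \<le> (1 + 1 / of_nat 40) ^ 40"
    by (simp add: field_simps)
  also have "\<dots> \<le> exp 1"
    by (rule exp_ge_one_plus_x_over_n_power_n) auto
  finally have e': "(268 / 100 :: real) \<le> exp 1" .
  have "(22 / 10 :: real) \<le> (1 + (84 / 100) / of_nat 10) ^ 10"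
    by (simp add: field_simps)
  also have "\<dots> \<le> exp (84 / 100)"
    by (rule exp_ge_one_plus_x_over_n_power_n) auto
  finally have *: "exp (- (84 / 100)) \<le> (10 / 22 :: real)"
    by (simp add: exp_minus field_simps)
  have "exp (1 / 2 - exp 1 / 2) \<le> exp (- (84 / 100) :: real)"
    using e' by simp
  with * e show ?thesis by linarith
qed

text \<open>A Chernoff bound with exponent \<open>1/2\<close> in which the tangent line of \<open>exp\<close> at the
  lower bound for the mean replaces Jensen's inequality.\<close>

lemma (in prob_space) complex_gaussian_prob_large_second_moment:
  fixes Z :: "'a \<Rightarrow> complex ^ 'n"
  assumes g: "complex_gaussian M Z B" and A: "A \<in> events" and "J \<noteq> {}"
    and cond: "op_norm (submatrix_on J (normalized_matrix B)) *
      op_norm (submatrix_inv J (normalized_matrix B)) \<le> c"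
    and c: "c \<le> 2 * exp 1 / 5"
    and large: "\<And>i. i \<in> J \<Longrightarrow> exp 1 * Re (B $ i $ i) * prob A \<le> (LINT \<omega>:A|M. (cmod (Z \<omega> $ i))\<^sup>2)"
  shows "prob A \<le> exp (- (1 / 2)) ^ card J"
proof -
  have pd: "pos_def_hermitian B"
    using g by (simp add: complex_gaussian_def)
  have [measurable]: "Z \<in> borel_measurable M" "A \<in> events"
    using g A by (auto intro: complex_gaussian_measurable)
  define v where "v i = Re (B $ i $ i)" for i
  have v: "0 < v i" for i
    unfolding v_def by (rule pos_def_hermitian_diag_pos[OF pd])
  define U where "U \<omega> = (\<Sum>i\<in>J. (cmod (Z \<omega> $ i))\<^sup>2 / v i) / 2" for \<omega>
  \<comment> \<open>Every index in \<open>J\<close> contributes at least e/2 to the conditional mean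
    of \<open>U\<close> over \<open>A\<close>.\<close>
  define m where "m = exp 1 / 2 * real (card J)"
  obtain i where "i \<in> J"
    using \<open>J \<noteq> {}\<close> by blast
  \<comment> \<open>With the second factor at least 1, the bound \<open>c\<close> on the product
    applies to the first factor alone.\<close>
  have "1 \<le> op_norm (submatrix_inv J (normalized_matrix B))"
    using op_norm_submatrix_inv_ge_1[OF pos_def_hermitian_normalized[OF pd] \<open>i \<in> J\<close>]
      normalized_matrix_diag[OF pd] by blast
  then have "op_norm (submatrix_on J (normalized_matrix B)) \<le> c"
    using cond mult_left_mono[OF _ op_norm_nonneg] by (metis mult.right_neutral order_trans)
  moreover have "c < 2"
    using c e_less_272 by linarith
  ultimately have nn: "(\<integral>\<^sup>+\<omega>. ennreal (exp (U \<omega>)) \<partial>M) \<le> ennreal ((1 / (1 - c / 2)) ^ card J)"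
    unfolding U_def v_def by (rule complex_gaussian_exp_square_moment[OF g])
  have [measurable]: "U \<in> borel_measurable M"
    unfolding U_def[abs_def] by measurable
  have int_exp: "integrable M (\<lambda>\<omega>. exp (U \<omega>))"
    using nn by (intro integrableI_bounded) (auto simp: less_top[symmetric] top_unique)
  have int_sq: "integrable M (\<lambda>\<omega>. (cmod (Z \<omega> $ i))\<^sup>2 / v i)" for i
    using complex_gaussian_component_moments(3)[OF g] by simp
  have int_U: "integrable M U"
    unfolding U_def[abs_def] by (intro integrable_divide Bochner_Integration.integrable_sum int_sq)
  have set_int_U: "set_integrable M A U"
    unfolding set_integrable_def by (intro integrable_mult_indicator A int_U)
  have "m * prob A = (\<Sum>i\<in>J. exp 1 * prob A) / 2"
    by (simp add: m_def)
  also have "\<dots> \<le> (\<Sum>i\<in>J. LINT \<omega>:A|M. (cmod (Z \<omega> $ i))\<^sup>2 / v i) / 2"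
  proof (intro divide_right_mono sum_mono)
    fix i assume "i \<in> J"
    from large[OF this] show "exp 1 * prob A \<le> (LINT \<omega>:A|M. (cmod (Z \<omega> $ i))\<^sup>2 / v i)"
      using v[of i] by (simp add: set_integral_divide_zero v_def field_simps)
  qed simp
  also have "(\<Sum>i\<in>J. LINT \<omega>:A|M. (cmod (Z \<omega> $ i))\<^sup>2 / v i)
      = (LINT \<omega>:A|M. (\<Sum>i\<in>J. (cmod (Z \<omega> $ i))\<^sup>2 / v i))"
    unfolding set_lebesgue_integral_def scaleR_sum_right
    by (rule Bochner_Integration.integral_sum[symmetric]) (intro integrable_mult_indicator A int_sq)
  also have "\<dots> / 2 = (LINT \<omega>:A|M. U \<omega>)"
    by (simp add: U_def set_lebesgue_integral_def)
  finally have mean: "m * prob A \<le> (LINT \<omega>:A|M. U \<omega>)" .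
  \<comment> \<open>The correction added on the right is nonnegative by \<open>mean\<close>, and the
    sum is the integral over \<open>A\<close> of the tangent line of \<open>exp\<close> at
    \<open>m\<close>.\<close>
  have "exp m * prob A \<le> exp m * (prob A + ((LINT \<omega>:A|M. U \<omega>) - m * prob A))"
    using mean by (intro mult_left_mono) auto
  also have "\<dots> = (LINT \<omega>:A|M. exp m * (1 + (U \<omega> - m)))"
  proof -
    have "set_integrable M A (\<lambda>\<omega>. 1 - m)"
      unfolding set_integrable_def by (intro integrable_mult_indicator A) simp
    from set_integral_add(2)[OF this set_int_U]
    have "(LINT \<omega>:A|M. 1 + (U \<omega> - m)) = prob A + ((LINT \<omega>:A|M. U \<omega>) - m * prob A)"
      by (simp add: set_integral_const algebra_simps emeasure_eq_measure)
    then show ?thesis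
      by (simp only: set_integral_mult_right)
  qed
  also have "\<dots> \<le> (LINT \<omega>:A|M. exp (U \<omega>))"
  proof (rule set_integral_mono)
    show "set_integrable M A (\<lambda>\<omega>. exp m * (1 + (U \<omega> - m)))"
      unfolding set_integrable_def
      by (intro integrable_mult_indicator A integrable_mult_right Bochner_Integration.integrable_add
          Bochner_Integration.integrable_diff int_U) auto
    show "set_integrable M A (\<lambda>\<omega>. exp (U \<omega>))"
      unfolding set_integrable_def by (intro integrable_mult_indicator A int_exp)
    show "exp m * (1 + (U \<omega> - m)) \<le> exp (U \<omega>)" for \<omega>
      using mult_left_mono[OF exp_ge_add_one_self[of "U \<omega> - m"], of "exp m"]
      by (simp flip: exp_add)
  qed
  also have "\<dots> \<le> (\<integral>\<omega>. exp (U \<omega>) \<partial>M)"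
    unfolding set_lebesgue_integral_def
    by (intro integral_mono integrable_mult_indicator A int_exp) (auto split: split_indicator)
  also have "\<dots> \<le> (1 / (1 - c / 2)) ^ card J"
    using nn \<open>c < 2\<close> int_exp by (simp add: nn_integral_eq_integral)
  \<comment> \<open>Here \<open>exp_numeric_bound\<close> enters: the part e/2 of the exponent is
    what \<open>exp m\<close> cancels for each index, and -1/2 remains.\<close>
  also have "\<dots> \<le> (exp (exp 1 / 2 - 1 / 2)) ^ card J"
  proof (intro power_mono)
    have "exp (1 / 2 - exp 1 / 2) \<le> 1 - c / 2"
      using exp_numeric_bound c by simp
    then have "1 / (1 - c / 2) \<le> 1 / exp (1 / 2 - exp 1 / 2)"
      by (intro divide_left_mono) (use \<open>c < 2\<close> in auto)
    then show "1 / (1 - c / 2) \<le> exp (exp 1 / 2 - 1 / 2)"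
      by (simp add: exp_diff)
  qed (use \<open>c < 2\<close> in auto)
  also have "\<dots> = exp m * exp (- (1 / 2)) ^ card J"
    by (simp add: m_def algebra_simps flip: exp_of_nat_mult exp_add)
  finally show ?thesis by simp
qed

text \<open>The left-hand side is the expectation of \<open>\<mu>\<close> to the power \<open>card (- S)\<close>, which
  is expanded over the subsets of \<open>S\<close> by the binomial formula for \<open>(1 - \<mu>) + \<mu> = 1\<close>.\<close>

lemma (in prob_space) sum_power_card_random_set_le:
  fixes S :: "'a \<Rightarrow> 'n::finite set"
  assumes meas: "\<And>i. {\<omega> \<in> space M. i \<in> S \<omega>} \<in> events"
    and \<mu>: "0 \<le> \<mu>" "\<mu> \<le> 1"
    and r: "\<And>J. prob {\<omega> \<in> space M. J \<subseteq> S \<omega>} \<le> r ^ card J"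
  shows "(\<Sum>J\<in>UNIV. \<mu> ^ card (- J) * prob {\<omega> \<in> space M. S \<omega> = J}) \<le> (\<mu> + (1 - \<mu>) * r) ^ CARD('n)"
proof -
  have [measurable]: "{\<omega> \<in> space M. S \<omega> = J} \<in> events" for J
  proof -
    have "{\<omega> \<in> space M. S \<omega> = J} = {\<omega> \<in> space M. \<forall>i. i \<in> S \<omega> \<longleftrightarrow> i \<in> J}"
      by auto
    also have "\<dots> \<in> events"
      using meas by measurable
    finally show ?thesis .
  qed
  have binom: "\<mu> ^ card (- J) = (\<Sum>K | K \<subseteq> J. (1 - \<mu>) ^ card K * \<mu> ^ card (- K))" for J :: "'n set"
  proof -
    have "\<mu> ^ card (- J) = (\<Prod>i\<in>J. (1 - \<mu>) + \<mu>) * \<mu> ^ card (- J)"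
      by simp
    also have "\<dots> = (\<Sum>K\<in>Pow J. (1 - \<mu>) ^ card K * \<mu> ^ card (J - K) * \<mu> ^ card (- J))"
      by (subst prod_add) (auto simp: sum_distrib_right)
    also have "\<dots> = (\<Sum>K\<in>Pow J. (1 - \<mu>) ^ card K * \<mu> ^ card (- K))"
    proof (intro sum.cong refl)
      fix K assume "K \<in> Pow J"
      then have "- K = (J - K) \<union> - J" by auto
      then have "card (- K) = card (J - K) + card (- J)"
        by (simp add: card_Un_disjoint Diff_Int_distrib2)
      then show "(1 - \<mu>) ^ card K * \<mu> ^ card (J - K) * \<mu> ^ card (- J) = (1 - \<mu>) ^ card K * \<mu> ^ card (- K)"
        by (simp add: power_add)
    qed
    finally show ?thesis by (simp add: Pow_def)
  qed
  have "(\<Sum>J\<in>UNIV. \<mu> ^ card (- J) * prob {\<omega> \<in> space M. S \<omega> = J})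
      = (\<Sum>J\<in>UNIV. \<Sum>K | K \<in> UNIV \<and> K \<subseteq> J. (1 - \<mu>) ^ card K * \<mu> ^ card (- K) * prob {\<omega> \<in> space M. S \<omega> = J})"
    by (intro sum.cong refl) (subst binom, simp add: sum_distrib_right)
  \<comment> \<open>After the exchange, the values \<open>J\<close> containing a fixed
    \<open>K\<close> recombine into the event \<open>K \<subseteq> S \<omega>\<close>, to which
    \<open>r\<close> applies.\<close>
  also have "\<dots> = (\<Sum>K\<in>UNIV. \<Sum>J | J \<in> UNIV \<and> K \<subseteq> J. (1 - \<mu>) ^ card K * \<mu> ^ card (- K) * prob {\<omega> \<in> space M. S \<omega> = J})"
    by (rule sum.swap_restrict) auto
  also have "\<dots> = (\<Sum>K\<in>UNIV. (1 - \<mu>) ^ card K * \<mu> ^ card (- K) * prob {\<omega> \<in> space M. K \<subseteq> S \<omega>})"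
  proof (intro sum.cong refl)
    fix K :: "'n set"
    have "prob (\<Union>J\<in>{J. K \<subseteq> J}. {\<omega> \<in> space M. S \<omega> = J}) = (\<Sum>J | K \<subseteq> J. prob {\<omega> \<in> space M. S \<omega> = J})"
      by (rule finite_measure_finite_Union) (auto simp: disjoint_family_on_def)
    also have "(\<Union>J\<in>{J. K \<subseteq> J}. {\<omega> \<in> space M. S \<omega> = J}) = {\<omega> \<in> space M. K \<subseteq> S \<omega>}"
      by auto
    finally show "(\<Sum>J | J \<in> UNIV \<and> K \<subseteq> J. (1 - \<mu>) ^ card K * \<mu> ^ card (- K) * prob {\<omega> \<in> space M. S \<omega> = J})
        = (1 - \<mu>) ^ card K * \<mu> ^ card (- K) * prob {\<omega> \<in> space M. K \<subseteq> S \<omega>}"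
      by (simp add: sum_distrib_left)
  qed
  also have "\<dots> \<le> (\<Sum>K\<in>(UNIV :: 'n set set). (1 - \<mu>) ^ card K * \<mu> ^ card (- K) * r ^ card K)"
    by (intro sum_mono mult_left_mono r) (use \<mu> in auto)
  \<comment> \<open>Nothing random is left, so the sum over subsets folds back into a product of
    equal factors.\<close>
  also have "\<dots> = (\<Sum>K\<in>Pow (UNIV :: 'n set). (\<Prod>i\<in>K. (1 - \<mu>) * r) * (\<Prod>i\<in>UNIV - K. \<mu>))"
    by (simp add: power_mult_distrib ac_simps Compl_eq_Diff_UNIV)
  also have "\<dots> = (\<mu> + (1 - \<mu>) * r) ^ CARD('n)"
    by (subst prod_add[symmetric]) (auto simp: add.commute)
  finally show ?thesis .
qed

section \<open>Combining independence, the tail of the random index set and the polydisc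
  bound\<close>

theorem corollary5p7:
  fixes M :: "'a measure"
    and X :: "'a \<Rightarrow> complex ^ 'n" and Y :: "'a \<Rightarrow> real ^ 'n"
    and B :: "complex ^ 'n ^ 'n"
    and c \<alpha> x :: real
  assumes "prob_space M"
    and "1 \<le> c" and "c \<le> 2 * exp 1 / 5" and "0 < \<alpha>"
    and "complex_gaussian M X B"
    and "Y \<in> borel_measurable M"
    and "indep_vectors M X Y"
    and "\<And>A. A \<in> sets (vimage_algebra (space M) Y borel) \<Longrightarrow> 0 < measure M A \<Longrightarrow>
      \<exists>(Z :: 'a \<Rightarrow> complex ^ 'n) (B\<^sub>A :: complex ^ 'n ^ 'n). complex_gaussian M Z B\<^sub>A \<and>
        (\<forall>i. (\<integral>\<omega>. \<bar>Y \<omega> $ i\<bar>\<^sup>2 \<partial>M) \<ge> \<alpha>\<^sup>2 * (\<integral>\<omega>. (cmod (Z \<omega> $ i))\<^sup>2 \<partial>M) \<and>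
             expectation_over M A (\<lambda>\<omega>. \<bar>Y \<omega> $ i\<bar>\<^sup>2) \<le>
             expectation_over M A (\<lambda>\<omega>. (cmod (Z \<omega> $ i))\<^sup>2)) \<and>
        (\<forall>I. I \<subset> UNIV \<longrightarrow>
             op_norm (submatrix_on (- I) (corr_matrix M Z)) *
             op_norm (submatrix_inv (- I) (corr_matrix M Z)) \<le> c)"
    and "0 \<le> x"
  shows "let C = corr_matrix M X;
             b = op_norm C * op_norm (matrix_inv C);
             \<mu> = 1 - exp (- (x\<^sup>2 / op_norm C))
         in measure M {\<omega> \<in> space M. \<exists>i.
              (cmod (X \<omega> $ i))\<^sup>2 \<ge> x\<^sup>2 * cvar M (\<lambda>\<omega>. X \<omega> $ i) \<and>
              \<bar>Y \<omega> $ i\<bar>\<^sup>2 \<le> exp 1 * ((\<integral>\<omega>. \<bar>Y \<omega> $ i\<bar>\<^sup>2 \<partial>M) / \<alpha>\<^sup>2)}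
            \<ge> 1 - 5 * exp 1 * (b * (\<mu> + (1 - \<mu>) * exp (- (1 / 2)))) ^ CARD('n)"
proof -
  interpret prob_space M by fact
  note gX = assms(5)
  have [measurable]: "X \<in> borel_measurable M" "Y \<in> borel_measurable M"
    using complex_gaussian_measurable[OF gX] assms(6) by auto
  have corr: "corr_matrix M W = normalized_matrix B'" if "complex_gaussian M W B'"
    for W :: "'a \<Rightarrow> complex ^ 'n" and B'
    by (rule complex_gaussian_corr_matrix[OF that])
  define thr where "thr i = exp 1 * ((\<integral>\<omega>. \<bar>Y \<omega> $ i\<bar>\<^sup>2 \<partial>M) / \<alpha>\<^sup>2)" for i
  define S where "S \<omega> = {i. thr i < \<bar>Y \<omega> $ i\<bar>\<^sup>2}" for \<omega>
  \<comment> \<open>\<open>S\<close> takes finitely many values, so every family of values gives an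
    event generated by \<open>Y\<close>. The families used are the supersets of a set and the
    singletons.\<close>
  have S_event: "{\<omega> \<in> space M. S \<omega> \<in> \<J>} \<in> sets (vimage_algebra (space M) Y borel)" for \<J>
  proof -
    have "{y :: real ^ 'n. {i. thr i < \<bar>y $ i\<bar>\<^sup>2} = J} \<in> sets borel" for J
    proof -
      have "{y :: real ^ 'n. {i. thr i < \<bar>y $ i\<bar>\<^sup>2} = J}
          = {y \<in> space borel. \<forall>i. thr i < \<bar>y $ i\<bar>\<^sup>2 \<longleftrightarrow> i \<in> J}"
        by auto
      also have "\<dots> \<in> sets borel"
        by measurable
      finally show ?thesis .
    qed
    then have "(\<Union>J\<in>\<J>. {y :: real ^ 'n. {i. thr i < \<bar>y $ i\<bar>\<^sup>2} = J}) \<in> sets borel"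
      by (intro sets.finite_UN) auto
    from in_vimage_algebra[OF this, of Y "space M"] show ?thesis
      by (simp add: vimage_def S_def Int_def conj_commute)
  qed
  have S_subset_event: "{\<omega> \<in> space M. J \<subseteq> S \<omega>} \<in> sets (vimage_algebra (space M) Y borel)" for J
    using S_event[of "{K. J \<subseteq> K}"] by simp
  have ind: "indep_set (sets (vimage_algebra (space M) X borel)) (sets (vimage_algebra (space M) Y borel))"
    using assms(7) by (simp only: indep_vectors_def)
  have sub: "sets (vimage_algebra (space M) Y borel) \<subseteq> events"
    by (rule indep_setD_ev2[OF ind])

  have tail: "prob {\<omega> \<in> space M. J \<subseteq> S \<omega>} \<le> exp (- (1 / 2)) ^ card J" for J
  \<comment> \<open>The hypothesis on \<open>Y\<close> concerns events of positive probability, and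
    \<open>J\<close> must be nonempty for its complement to be a proper subset.\<close>
  proof (cases "J = {} \<or> prob {\<omega> \<in> space M. J \<subseteq> S \<omega>} = 0")
    case True
    then show ?thesis by auto
  next
    case False
    define A where "A = {\<omega> \<in> space M. J \<subseteq> S \<omega>}"
    have A: "A \<in> sets (vimage_algebra (space M) Y borel)" "0 < prob A"
      using S_subset_event False unfolding A_def by (auto simp: zero_less_measure_iff)
    then have A_event: "A \<in> events"
      using sub by blast
    from assms(8)[OF A] obtain Z :: "'a \<Rightarrow> complex ^ 'n" and B' where
      gZ: "complex_gaussian M Z B'"
      and mean: "\<And>i. (\<integral>\<omega>. \<bar>Y \<omega> $ i\<bar>\<^sup>2 \<partial>M) \<ge> \<alpha>\<^sup>2 * (\<integral>\<omega>. (cmod (Z \<omega> $ i))\<^sup>2 \<partial>M)"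
      and mean_A: "\<And>i. expectation_over M A (\<lambda>\<omega>. \<bar>Y \<omega> $ i\<bar>\<^sup>2) \<le>
             expectation_over M A (\<lambda>\<omega>. (cmod (Z \<omega> $ i))\<^sup>2)"
      and cond: "\<And>I. I \<subset> UNIV \<Longrightarrow> op_norm (submatrix_on (- I) (corr_matrix M Z)) *
             op_norm (submatrix_inv (- I) (corr_matrix M Z)) \<le> c"
      by auto
    have pd: "pos_def_hermitian B'"
      using gZ by (simp add: complex_gaussian_def)
    have "prob A \<le> exp (- (1 / 2)) ^ card J"
    proof (rule complex_gaussian_prob_large_second_moment[OF gZ A_event])
      show "J \<noteq> {}" using False by blast
      then have "- J \<subset> UNIV" by blast
      from cond[OF this] show "op_norm (submatrix_on J (normalized_matrix B')) *
          op_norm (submatrix_inv J (normalized_matrix B')) \<le> c"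
        by (simp add: corr[OF gZ])
      show "c \<le> 2 * exp 1 / 5" by fact
      fix i assume "i \<in> J"
      have le: "\<alpha>\<^sup>2 * Re (B' $ i $ i) \<le> (\<integral>\<omega>. \<bar>Y \<omega> $ i\<bar>\<^sup>2 \<partial>M)"
        using mean[of i] by (simp only: complex_gaussian_component_moments(4)[OF gZ])
      then have "exp 1 * Re (B' $ i $ i) \<le> thr i"
        using \<open>0 < \<alpha>\<close> by (simp add: thr_def field_simps)
      \<comment> \<open>A nonintegrable function has integral 0 by convention, so the positive lower
        bound for the second moment of \<open>Y\<close> proves its integrability.\<close>
      have "0 < \<alpha>\<^sup>2 * Re (B' $ i $ i)"
        using \<open>0 < \<alpha>\<close> pos_def_hermitian_diag_pos[OF pd, of i] by simp
      with le have "(\<integral>\<omega>. \<bar>Y \<omega> $ i\<bar>\<^sup>2 \<partial>M) \<noteq> 0"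
        by linarith
      then have int_Y: "integrable M (\<lambda>\<omega>. \<bar>Y \<omega> $ i\<bar>\<^sup>2)"
        using not_integrable_integral_eq by blast
      \<comment> \<open>The chain leads from the variance of the \<open>i\<close>-th coordinate of
        \<open>Z\<close> to the threshold, on \<open>A\<close> from the threshold to
        \<open>Y\<close>, and by the conditional hypothesis back to \<open>Z\<close>.\<close>
      have "exp 1 * Re (B' $ i $ i) * prob A \<le> thr i * prob A"
        using \<open>exp 1 * Re (B' $ i $ i) \<le> thr i\<close> by (intro mult_right_mono) auto
      also have "\<dots> = (LINT \<omega>:A|M. thr i)"
        using A_event by (simp add: set_integral_const emeasure_eq_measure)
      also have "\<dots> \<le> (LINT \<omega>:A|M. \<bar>Y \<omega> $ i\<bar>\<^sup>2)"
      proof (rule set_integral_mono)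
        show "set_integrable M A (\<lambda>\<omega>. thr i)"
          unfolding set_integrable_def by (intro integrable_mult_indicator A_event) simp
        show "set_integrable M A (\<lambda>\<omega>. \<bar>Y \<omega> $ i\<bar>\<^sup>2)"
          unfolding set_integrable_def by (intro integrable_mult_indicator A_event int_Y)
        show "thr i \<le> \<bar>Y \<omega> $ i\<bar>\<^sup>2" if "\<omega> \<in> A" for \<omega>
          using that \<open>i \<in> J\<close> unfolding A_def S_def by fastforce
      qed
      also have "\<dots> \<le> (LINT \<omega>:A|M. (cmod (Z \<omega> $ i))\<^sup>2)"
        using mean_A[of i] A(2) unfolding expectation_over_def by (simp only: divide_le_cancel)
      finally show "exp 1 * Re (B' $ i $ i) * prob A \<le> (LINT \<omega>:A|M. (cmod (Z \<omega> $ i))\<^sup>2)" .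
    qed
    then show ?thesis unfolding A_def .
  qed

  define C where "C = normalized_matrix B"
  define b where "b = op_norm C * op_norm (matrix_inv C)"
  define \<mu> where "\<mu> = 1 - exp (- (x\<^sup>2 / op_norm C))"
  define p where "p = \<mu> + (1 - \<mu>) * exp (- (1 / 2))"
  have \<mu>: "0 \<le> \<mu>" "\<mu> \<le> 1"
    by (simp_all add: \<mu>_def op_norm_nonneg)
  have b: "0 \<le> b"
    by (simp add: b_def op_norm_nonneg)
  have bp: "0 \<le> (b * p) ^ CARD('n)"
    unfolding p_def using b \<mu> by simp
  define E where "E J = {\<omega> \<in> space M. \<forall>i\<in>- J. (cmod (X \<omega> $ i))\<^sup>2 < x\<^sup>2 * Re (B $ i $ i)}" for J
  have E_event: "E J \<in> sets (vimage_algebra (space M) X borel)" for J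
  proof -
    have "{z \<in> space borel. \<forall>i\<in>- J. (cmod (z $ i))\<^sup>2 < x\<^sup>2 * Re (B $ i $ i)} \<in> sets borel"
      by measurable
    from in_vimage_algebra[OF this, of X "space M"] show ?thesis
      by (simp add: vimage_def E_def Int_def conj_commute)
  qed
  have SJ_event: "{\<omega> \<in> space M. S \<omega> = J} \<in> sets (vimage_algebra (space M) Y borel)" for J
    using S_event[of "{J}"] by simp
  have E_le: "prob (E J) \<le> b ^ CARD('n) * \<mu> ^ card (- J)" for J
    unfolding E_def b_def \<mu>_def C_def by (rule complex_gaussian_small_ball[OF gX])
  have indep: "prob (E J \<inter> {\<omega> \<in> space M. S \<omega> = J}) = prob (E J) * prob {\<omega> \<in> space M. S \<omega> = J}" for J
    by (rule indep_setD[OF ind E_event SJ_event])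
  have events: "E J \<inter> {\<omega> \<in> space M. S \<omega> = J} \<in> events" for J
    using indep_setD_ev1[OF ind] E_event sub SJ_event by blast
  define G where "G = {\<omega> \<in> space M. \<exists>i. (cmod (X \<omega> $ i))\<^sup>2 \<ge> x\<^sup>2 * cvar M (\<lambda>\<omega>. X \<omega> $ i) \<and>
      \<bar>Y \<omega> $ i\<bar>\<^sup>2 \<le> exp 1 * ((\<integral>\<omega>. \<bar>Y \<omega> $ i\<bar>\<^sup>2 \<partial>M) / \<alpha>\<^sup>2)}"
  have G_event: "G \<in> events"
    unfolding G_def by measurable
  have G_eq: "G = {\<omega> \<in> space M. \<exists>i. x\<^sup>2 * Re (B $ i $ i) \<le> (cmod (X \<omega> $ i))\<^sup>2 \<and> i \<notin> S \<omega>}"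
    by (simp only: G_def complex_gaussian_cvar[OF gX] S_def thr_def mem_Collect_eq not_less)
  \<comment> \<open>Splitting by the value of \<open>S\<close> makes each piece an intersection of
    an event of \<open>X\<close> with an event of \<open>Y\<close>, to which independence
    applies.\<close>
  have G_compl: "space M - G = (\<Union>J\<in>UNIV. E J \<inter> {\<omega> \<in> space M. S \<omega> = J})"
  proof -
    have "\<omega> \<in> space M - G \<longleftrightarrow> \<omega> \<in> space M \<and> \<omega> \<in> E (S \<omega>)" for \<omega>
      by (simp only: G_eq E_def Diff_iff mem_Collect_eq Compl_iff Ball_def) (meson not_le)
    then show ?thesis by blast
  qed
  have "prob (space M - G) \<le> (\<Sum>J\<in>UNIV. prob (E J \<inter> {\<omega> \<in> space M. S \<omega> = J}))"
    unfolding G_compl by (rule finite_measure_subadditive_finite) (use events in auto)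
  also have "\<dots> \<le> (\<Sum>J\<in>UNIV. b ^ CARD('n) * \<mu> ^ card (- J) * prob {\<omega> \<in> space M. S \<omega> = J})"
    unfolding indep by (intro sum_mono mult_right_mono E_le) simp
  also have "\<dots> = b ^ CARD('n) * (\<Sum>J\<in>UNIV. \<mu> ^ card (- J) * prob {\<omega> \<in> space M. S \<omega> = J})"
    by (simp add: sum_distrib_left mult.assoc)
  also have "\<dots> \<le> b ^ CARD('n) * p ^ CARD('n)"
    unfolding p_def
  proof (intro mult_left_mono sum_power_card_random_set_le \<mu> tail)
    show "{\<omega> \<in> space M. i \<in> S \<omega>} \<in> events" for i
      using S_subset_event[of "{i}"] sub by auto
  qed (use b in simp)
  also have "\<dots> = (b * p) ^ CARD('n)"
    by (simp add: power_mult_distrib)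
  \<comment> \<open>The power is nonnegative and 5e is at least 1.\<close>
  also have "\<dots> \<le> 5 * exp 1 * (b * p) ^ CARD('n)"
  proof -
    have "1 \<le> 5 * exp (1 :: real)"
      using exp_ge_add_one_self[of 1] by linarith
    from mult_right_mono[OF this bp] show ?thesis by simp
  qed
  finally have "1 - 5 * exp 1 * (b * p) ^ CARD('n) \<le> prob G"
    using prob_compl[OF G_event] by simp
  then show ?thesis
    unfolding Let_def corr[OF gX] G_def p_def \<mu>_def b_def C_def .
qed

end
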